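(* Let $\mathfrak{g}=A_r=\mathfrak{sl}_{r+1}$ and $i,j\in\{1,\dots,r\}$. Consider the Cartan braiding $\sigma: \mathcal{B}(\omega_i) \otimes \mathcal{B}(\omega_j) \to \mathcal{B}(\omega_j) \otimes \mathcal{B}(\omega_i)$ restricted to the Cartan components of the two tensor products. Then $\sigma(b \otimes b')$ can be obtained by applying jeu de taquin slides to the (skew) tableau corresponding to $b \otimes b'$; that is, the two-column (skew) tableau corresponding to $\sigma(b\otimes b')$ is obtained by jeu de taquin slides from the one corresponding to $b\otimes b'$.
   Context: **Crystals.** For a dominant weight $\lambda$, $\mathcal{B}(\lambda)$ is the (connected) Kashiwara crystal of the irreducible module of highest weight $\lambda$, with Kashiwara operators $\tilde E_i,\tilde F_i$ and $\varepsilon_i(b)=\max\{k:\tilde E_i^k b\neq 0\}$, $\varphi_i(b)=\max\{k:\tilde F_i^k b\neq0\}$. Tensor products use the convention: $\tilde E_i(b\otimes b')=\tilde E_i b\otimes b'$ if $\varphi_i(b)\ge\varepsilon_i(b')$ and $b\otimes\tilde E_i b'$ otherwise; $\tilde F_i(b\otimes b')=\tilde F_i b\otimes b'$ if $\varphi_i(b)>\varepsilon_i(b')$ and $b\otimes\tilde F_i b'$ otherwise. The Cartan component of $\mathcal{B}(\lambda)\otimes\mathcal{B}(\lambda')$ is its unique connected component isomorphic to $\mathcal{B}(\lambda+\lambda')$. **Cartan braiding.** $\sigma_{\mathcal{B}(\lambda),\mathcal{B}(\lambda')}:\mathcal{B}(\lambda)\otimes\mathcal{B}(\lambda')\to\mathcal{B}(\lambda')\otimes\mathcal{B}(\lambda)$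 is the unique morphism of crystals which is an isomorphism between the Cartan components of the two tensor products and is zero on all other connected components. **Tableaux.** Elements of $\mathcal{B}(\omega_k)$ are identified with strictly increasing columns of length $k$ with entries in $\{1,\dots,r+1\}$, where $\tilde F_i$ replaces the entry $i$ by $i+1$ if $i$ occurs and $i+1$ does not, and is $0$ otherwise. An element $b\otimes b'$ of the Cartan component of $\mathcal{B}(\omega_i)\otimes\mathcal{B}(\omega_j)$ corresponds to the semistandard two-column (skew) tableau with left column $b'$ (length $j$) and right column $b$ (length $i$): if $i\le j$ the columns are top-aligned (an ordinary straight-shape tableau), and if $i\ge j$ they are bottom-aligned (skew shape $(2^i)/(1^{i-j})$). *)

theory Defs
  imports Main
begin

section \<open>Crystals\<close>

text \<open>The extra element \<open>0\<close> of a crystal is \<open>None\<close>. A weight is given by its coefficients on the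
  fundamental weights, so \<open>wt A b i\<close> is the value of the weight of \<open>b\<close> on the \<open>i\<close>-th simple
  coroot. The index set \<open>I\<close> of the simple roots is passed separately; everything outside \<open>I\<close>,
  respectively outside \<open>elems A\<close>, is irrelevant.\<close>

record 'a crystal =
  elems :: "'a set"
  wt :: "'a \<Rightarrow> nat \<Rightarrow> int"
  Eop :: "nat \<Rightarrow> 'a \<Rightarrow> 'a option"
  Fop :: "nat \<Rightarrow> 'a \<Rightarrow> 'a option"

definition iter_op :: "('a \<Rightarrow> 'a option) \<Rightarrow> nat \<Rightarrow> 'a \<Rightarrow> 'a option" where
  "iter_op h k b = ((\<lambda>z. Option.bind z h) ^^ k) (Some b)"

definition eps :: "'a crystal \<Rightarrow> nat \<Rightarrow> 'a \<Rightarrow> nat" where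
  "eps A i b = (GREATEST k. iter_op (Eop A i) k b \<noteq> None)"

definition phi :: "'a crystal \<Rightarrow> nat \<Rightarrow> 'a \<Rightarrow> nat" where
  "phi A i b = (GREATEST k. iter_op (Fop A i) k b \<noteq> None)"

definition tensor :: "'a crystal \<Rightarrow> 'b crystal \<Rightarrow> ('a \<times> 'b) crystal" where
  "tensor A B = \<lparr>
     elems = elems A \<times> elems B,
     wt = (\<lambda>(b, b') i. wt A b i + wt B b' i),
     Eop = (\<lambda>i (b, b').
       if phi A i b \<ge> eps B i b' then map_option (\<lambda>x. (x, b')) (Eop A i b)
       else map_option (\<lambda>y. (b, y)) (Eop B i b')),
     Fop = (\<lambda>i (b, b').
       if phi A i b > eps B i b' then map_option (\<lambda>x. (x, b')) (Fop A i b)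
       else map_option (\<lambda>y. (b, y)) (Fop B i b'))\<rparr>"

definition subcrystal :: "'a crystal \<Rightarrow> 'a set \<Rightarrow> 'a crystal" where
  "subcrystal A S = A\<lparr>elems := S\<rparr>"

definition crystal_morphism ::
  "nat set \<Rightarrow> 'a crystal \<Rightarrow> 'b crystal \<Rightarrow> ('a \<Rightarrow> 'b option) \<Rightarrow> bool" where
  "crystal_morphism I A B \<psi> \<longleftrightarrow>
     (\<forall>x \<in> elems A. \<forall>y. \<psi> x = Some y \<longrightarrow>
        y \<in> elems B \<and>
        (\<forall>i \<in> I. wt B y i = wt A x i \<and> eps B i y = eps A i x \<and> phi B i y = phi A i x)) \<and>
     (\<forall>x \<in> elems A. \<forall>i \<in> I.
        Option.bind (Eop A i x) \<psi> = Option.bind (\<psi> x) (Eop B i) \<and>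
        Option.bind (Fop A i x) \<psi> = Option.bind (\<psi> x) (Fop B i))"

definition crystal_iso ::
  "nat set \<Rightarrow> 'a crystal \<Rightarrow> 'b crystal \<Rightarrow> ('a \<Rightarrow> 'b option) \<Rightarrow> bool" where
  "crystal_iso I A B \<psi> \<longleftrightarrow>
     crystal_morphism I A B \<psi> \<and>
     (\<forall>x \<in> elems A. \<psi> x \<noteq> None) \<and>
     bij_betw (\<lambda>x. the (\<psi> x)) (elems A) (elems B)"

definition crystal_graph :: "nat set \<Rightarrow> 'a crystal \<Rightarrow> ('a \<times> 'a) set" where
  "crystal_graph I A =
     {(x, y). x \<in> elems A \<and> y \<in> elems A \<and> (\<exists>i \<in> I. Fop A i x = Some y)}"

definition connected_components :: "nat set \<Rightarrow> 'a crystal \<Rightarrow> 'a set set" where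
  "connected_components I A = elems A // (crystal_graph I A \<union> (crystal_graph I A)\<inverse>)\<^sup>*"


section \<open>The crystals of type A\<close>

text \<open>Strictly increasing columns, read from top to bottom, with entries in \<open>{1..r+1}\<close>.\<close>

definition columns :: "nat \<Rightarrow> nat list set" where
  "columns r = {c. sorted_wrt (<) c \<and> set c \<subseteq> {1..r + 1}}"

definition column_crystal :: "nat \<Rightarrow> nat list crystal" where
  "column_crystal r = \<lparr>
     elems = columns r,
     wt = (\<lambda>c i. of_bool (i \<in> set c) - of_bool (i + 1 \<in> set c)),
     Eop = (\<lambda>i c. if i + 1 \<in> set c \<and> i \<notin> set c
                   then Some (map (\<lambda>x. if x = i + 1 then i else x) c) else None),
     Fop = (\<lambda>i c. if i \<in> set c \<and> i + 1 \<notin> set c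
                   then Some (map (\<lambda>x. if x = i then i + 1 else x) c) else None)\<rparr>"

text \<open>\<open>tensor_power A n\<close> is \<open>A \<otimes> (A \<otimes> (\<dots> \<otimes> trivial))\<close> with \<open>b\<^sub>1 \<otimes> \<dots> \<otimes> b\<^sub>n\<close> written as the
  list \<open>[b\<^sub>1, \<dots>, b\<^sub>n]\<close>.\<close>

definition cons_crystal :: "('a \<times> 'a list) crystal \<Rightarrow> 'a list crystal" where
  "cons_crystal B = \<lparr>
     elems = (\<lambda>(x, xs). x # xs) ` elems B,
     wt = (\<lambda>l. wt B (hd l, tl l)),
     Eop = (\<lambda>i l. map_option (\<lambda>(x, xs). x # xs) (Eop B i (hd l, tl l))),
     Fop = (\<lambda>i l. map_option (\<lambda>(x, xs). x # xs) (Fop B i (hd l, tl l)))\<rparr>"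

primrec tensor_power :: "'a crystal \<Rightarrow> nat \<Rightarrow> 'a list crystal" where
  "tensor_power A 0 =
     \<lparr>elems = {[]}, wt = (\<lambda>_ _. 0), Eop = (\<lambda>_ _. None), Fop = (\<lambda>_ _. None)\<rparr>"
| "tensor_power A (Suc n) = cons_crystal (tensor A (tensor_power A n))"

text \<open>A dominant weight \<open>\<Sum>k=1..r. \<nu>\<^sub>k \<omega>\<^sub>k\<close> of \<open>sl\<^bsub>r+1\<^esub>\<close> is the function \<open>k \<mapsto> \<nu>\<^sub>k\<close>. The crystal of the
  irreducible module of highest weight \<open>\<nu>\<close> is taken in the tableau realisation of Kashiwara and
  Nakashima: semistandard tableaux with \<open>\<nu>\<^sub>k\<close> columns of length \<open>k\<close>, with the operators of the
  tensor product of their columns taken from right to left. Accordingly a tableau is the list of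
  its columns from right to left, and its column lengths increase along the list.\<close>

definition tableaux :: "nat \<Rightarrow> (nat \<Rightarrow> nat) \<Rightarrow> nat list list set" where
  "tableaux r \<nu> =
     {T. set T \<subseteq> columns r \<and>
         length ` set T \<subseteq> {1..r} \<and>
         (\<forall>k \<in> {1..r}. count_list (map length T) k = \<nu> k) \<and>
         sorted (map length T) \<and>
         (\<forall>m. Suc m < length T \<longrightarrow> (\<forall>a < length (T ! m). T ! Suc m ! a \<le> T ! m ! a))}"

definition hw_crystal :: "nat \<Rightarrow> (nat \<Rightarrow> nat) \<Rightarrow> nat list list crystal" where
  "hw_crystal r \<nu> =
     subcrystal (tensor_power (column_crystal r) (\<Sum>k = 1..r. \<nu> k)) (tableaux r \<nu>)"

definition fund_wt :: "nat \<Rightarrow> nat \<Rightarrow> nat" where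
  "fund_wt k = (\<lambda>m. if m = k then 1 else 0)"

text \<open>The crystal of the \<open>k\<close>-th fundamental weight consists of the tableaux \<open>[c]\<close> with a single
  column \<open>c\<close> of length \<open>k\<close>, with the operators of the column crystal.\<close>

lemma elems_hw_crystal_fund:
  assumes "k \<in> {1..r}"
  shows "elems (hw_crystal r (fund_wt k)) = (\<lambda>c. [c]) ` {c \<in> columns r. length c = k}"
proof -
  have "\<exists>c. T = [c] \<and> length c = k"
    if l: "length ` set T \<subseteq> {1..r}"
      and n: "\<forall>m \<in> {1..r}. count_list (map length T) m = fund_wt k m" for T :: "nat list list"
  proof -
    have sub: "set (map length T) \<subseteq> {1..r}" using l by auto
    have "length (map length T) = sum (count_list (map length T)) {1..r}"
      using sum_count_set[OF sub] by simp
    also have "\<dots> = sum (fund_wt k) {1..r}" by (rule sum.cong) (use n in auto)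
    also have "\<dots> = 1" using assms by (simp add: fund_wt_def)
    finally obtain c where T: "T = [c]" by (auto simp: length_Suc_conv)
    have "count_list (map length T) k = 1" using n assms by (auto simp: fund_wt_def)
    then show ?thesis using T by (auto split: if_splits)
  qed
  then show ?thesis
    using assms
    by (fastforce simp: hw_crystal_def subcrystal_def tableaux_def fund_wt_def)
qed

lemma ops_hw_crystal_fund:
  assumes "k \<in> {1..r}"
  shows "Fop (hw_crystal r (fund_wt k)) i [c] = map_option (\<lambda>c. [c]) (Fop (column_crystal r) i c)"
    and "Eop (hw_crystal r (fund_wt k)) i [c] = map_option (\<lambda>c. [c]) (Eop (column_crystal r) i c)"
proof -
  let ?A = "column_crystal r" and ?T = "tensor_power (column_crystal r) 0"
  have one: "(\<Sum>m = 1..r. fund_wt k m) = 1" using assms by (simp add: fund_wt_def)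
  have triv: "iter_op (Eop ?T i) n [] \<noteq> None \<longleftrightarrow> n = 0" for n
    by (cases n) (auto simp: iter_op_def split: bind_splits)
  have e: "eps ?T i [] = 0"
    unfolding eps_def triv by (rule Greatest_equality) auto
  have ph: "phi ?A i c > 0" if d: "Fop ?A i c = Some d" for d
  proof -
    have "Fop ?A i d = None"
      using d by (auto simp: column_crystal_def split: if_splits)
    then have b: "n \<le> 1" if "iter_op (Fop ?A i) n c \<noteq> None" for n
    proof (rule_tac ccontr)
      assume "\<not> n \<le> 1"
      then obtain m where m: "n = m + 2" by (metis add.commute le_Suc_ex not_less_eq_eq one_add_one plus_1_eq_Suc)
      have "((\<lambda>z. Option.bind z (Fop ?A i)) ^^ m) None = None" for m by (induction m) auto
      then have "iter_op (Fop ?A i) n c = None"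
        using d \<open>Fop ?A i d = None\<close> unfolding iter_op_def m funpow_add
        by (simp add: numeral_2_eq_2)
      then show False using that by simp
    qed
    have "iter_op (Fop ?A i) 1 c \<noteq> None" using d by (simp add: iter_op_def)
    then have "1 \<le> phi ?A i c" unfolding phi_def using b by (rule Greatest_le_nat) auto
    then show ?thesis by simp
  qed
  show "Fop (hw_crystal r (fund_wt k)) i [c] = map_option (\<lambda>c. [c]) (Fop ?A i c)"
    using ph e one
    by (cases "Fop ?A i c")
      (auto simp: hw_crystal_def subcrystal_def cons_crystal_def tensor_def)
  show "Eop (hw_crystal r (fund_wt k)) i [c] = map_option (\<lambda>c. [c]) (Eop ?A i c)"
    using e one
    by (auto simp: hw_crystal_def subcrystal_def cons_crystal_def tensor_def option.map_comp o_def)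
qed


section \<open>Cartan components and the Cartan braiding\<close>

definition cartan_component ::
  "nat \<Rightarrow> (nat \<Rightarrow> nat) \<Rightarrow> (nat \<Rightarrow> nat) \<Rightarrow> (nat list list \<times> nat list list) set" where
  "cartan_component r \<nu> \<mu> =
     (THE C. C \<in> connected_components {1..r} (tensor (hw_crystal r \<nu>) (hw_crystal r \<mu>)) \<and>
             (\<exists>\<psi>. crystal_iso {1..r} (subcrystal (tensor (hw_crystal r \<nu>) (hw_crystal r \<mu>)) C)
                     (hw_crystal r (\<lambda>k. \<nu> k + \<mu> k)) \<psi>))"

text \<open>The last conjunct says that \<open>\<sigma>\<close> is zero on all other components; it also fixes the
  irrelevant values of \<open>\<sigma>\<close> outside the crystal, so that \<open>\<sigma>\<close> is unique.\<close>

definition cartan_braiding ::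
  "nat \<Rightarrow> (nat \<Rightarrow> nat) \<Rightarrow> (nat \<Rightarrow> nat) \<Rightarrow>
   nat list list \<times> nat list list \<Rightarrow> (nat list list \<times> nat list list) option" where
  "cartan_braiding r \<nu> \<mu> =
     (THE \<sigma>.
        crystal_morphism {1..r} (tensor (hw_crystal r \<nu>) (hw_crystal r \<mu>))
          (tensor (hw_crystal r \<mu>) (hw_crystal r \<nu>)) \<sigma> \<and>
        crystal_iso {1..r}
          (subcrystal (tensor (hw_crystal r \<nu>) (hw_crystal r \<mu>)) (cartan_component r \<nu> \<mu>))
          (subcrystal (tensor (hw_crystal r \<mu>) (hw_crystal r \<nu>)) (cartan_component r \<mu> \<nu>)) \<sigma> \<and>
        (\<forall>x. x \<notin> cartan_component r \<nu> \<mu> \<longrightarrow> \<sigma> x = None))"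


section \<open>Skew tableaux and jeu de taquin\<close>

text \<open>A cell is a pair (row, column), both counted from 1, with rows going downwards. A filling is
  a partial function on cells whose domain is the shape.\<close>

type_synonym filling = "nat \<times> nat \<Rightarrow> nat option"

definition young_diagram :: "(nat \<times> nat) set \<Rightarrow> bool" where
  "young_diagram D \<longleftrightarrow>
     finite D \<and> (\<forall>(a, b) \<in> D. 1 \<le> a \<and> 1 \<le> b) \<and>
     (\<forall>a b a' b'. (a, b) \<in> D \<longrightarrow> 1 \<le> a' \<longrightarrow> a' \<le> a \<longrightarrow> 1 \<le> b' \<longrightarrow> b' \<le> b \<longrightarrow> (a', b') \<in> D)"

definition semistandard :: "filling \<Rightarrow> bool" where
  "semistandard T \<longleftrightarrow>
     (\<forall>a b b' x y. b < b' \<longrightarrow> T (a, b) = Some x \<longrightarrow> T (a, b') = Some y \<longrightarrow> x \<le> y) \<and>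
     (\<forall>a a' b x y. a < a' \<longrightarrow> T (a, b) = Some x \<longrightarrow> T (a', b) = Some y \<longrightarrow> x < y)"

text \<open>\<open>slide_in c T T'\<close>: starting from the empty cell \<open>c\<close>, the smaller of the entries to the right
  of and below the hole moves into it (the one below in case of equality), until the hole has
  neither neighbour.\<close>

inductive slide_in :: "nat \<times> nat \<Rightarrow> filling \<Rightarrow> filling \<Rightarrow> bool" where
  stop: "T (Suc a, b) = None \<Longrightarrow> T (a, Suc b) = None \<Longrightarrow> slide_in (a, b) T T"
| up: "T (Suc a, b) = Some y \<Longrightarrow> (\<And>x. T (a, Suc b) = Some x \<Longrightarrow> y \<le> x) \<Longrightarrow>
    slide_in (Suc a, b) (T((a, b) := Some y, (Suc a, b) := None)) T' \<Longrightarrow>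
    slide_in (a, b) T T'"
| left: "T (a, Suc b) = Some x \<Longrightarrow> (\<And>y. T (Suc a, b) = Some y \<Longrightarrow> x < y) \<Longrightarrow>
    slide_in (a, Suc b) (T((a, b) := Some x, (a, Suc b) := None)) T' \<Longrightarrow>
    slide_in (a, b) T T'"

text \<open>The reverse slide: the larger of the entries to the left of and above the hole moves into it
  (the one above in case of equality).\<close>

inductive slide_out :: "nat \<times> nat \<Rightarrow> filling \<Rightarrow> filling \<Rightarrow> bool" where
  stop: "T (a, Suc b) = None \<Longrightarrow> T (Suc a, b) = None \<Longrightarrow> slide_out (Suc a, Suc b) T T"
| down: "T (a, Suc b) = Some y \<Longrightarrow> (\<And>x. T (Suc a, b) = Some x \<Longrightarrow> x \<le> y) \<Longrightarrow>
    slide_out (a, Suc b) (T((Suc a, Suc b) := Some y, (a, Suc b) := None)) T' \<Longrightarrow>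
    slide_out (Suc a, Suc b) T T'"
| right: "T (Suc a, b) = Some x \<Longrightarrow> (\<And>y. T (a, Suc b) = Some y \<Longrightarrow> y < x) \<Longrightarrow>
    slide_out (Suc a, b) (T((Suc a, Suc b) := Some x, (Suc a, b) := None)) T' \<Longrightarrow>
    slide_out (Suc a, Suc b) T T'"

text \<open>A slide of a semistandard filling of the skew shape \<open>\<Lambda> - M\<close>, either into a corner of the
  inner diagram \<open>M\<close> or into an outer corner of \<open>\<Lambda>\<close>.\<close>

definition jdt_slide :: "filling \<Rightarrow> filling \<Rightarrow> bool" where
  "jdt_slide T T' \<longleftrightarrow>
     semistandard T \<and>
     (\<exists>\<Lambda> M c. young_diagram \<Lambda> \<and> young_diagram M \<and> M \<subseteq> \<Lambda> \<and> dom T = \<Lambda> - M \<and>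
        (c \<in> M \<and> young_diagram (M - {c}) \<and> slide_in c T T' \<or>
         c \<notin> \<Lambda> \<and> young_diagram (insert c \<Lambda>) \<and> slide_out c T T'))"

text \<open>The filling with right column \<open>b\<close> and left column \<open>b'\<close>: \<open>b\<close> starts in row 1, and \<open>b'\<close> is
  moved down by \<open>length b - length b'\<close> rows, which as a truncated difference is zero if \<open>b'\<close> is
  at least as long. So the columns are top-aligned if \<open>length b \<le> length b'\<close> and bottom-aligned
  if \<open>length b \<ge> length b'\<close>.\<close>

definition two_column :: "nat list \<Rightarrow> nat list \<Rightarrow> filling" where
  "two_column b b' =
     (let s = length b - length b' in
      (\<lambda>(a, k).
        if k = 2 \<and> 1 \<le> a \<and> a \<le> length b then Some (b ! (a - 1))
        else if k = 1 \<and> s < a \<and> a \<le> s + length b' then Some (b' ! (a - s - 1))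
        else None))"

end

theory Submission
  imports Defs
begin

text \<open>A pair of columns \<open>b \<otimes> b'\<close> is a pair of sets \<open>(A, B)\<close>, the entries of the right and of the left
  column. Everything is read off the walk \<open>excess (A, B) v\<close>, the number of entries of \<open>B\<close> up to \<open>v\<close>
  minus the number of entries of \<open>A\<close> up to \<open>v\<close>. Its steps are in \<open>{-1, 0, 1}\<close>, it starts at \<open>0\<close> and
  ends at \<open>card B - card A\<close>. The columns, with the left one moved down by \<open>t\<close> rows, form a
  semistandard filling of skew shape exactly if the walk stays at or above \<open>-t\<close>
  (\<open>excess_bound_iff_dominates\<close>). A crystal operator changes the walk in one point only, and never
  changes its minimum (\<open>min_excess_pair_op\<close>).

  Let the minimum of the walk be below its final value, and let \<open>x\<close> be the place just after the
  last minimum. Then \<open>x\<close> is in \<open>B\<close> and not in \<open>A\<close>. Moving \<open>x\<close> from \<open>B\<close> to \<open>A\<close> lowers the minimum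
  by one; it is injective, as \<open>x\<close> is the first place where the new walk is minimal; and it
  commutes with all crystal operators (\<open>pairF_transfer_Some\<close>, \<open>pair_op_transfer_None\<close>). In terms of
  brackets, with opening brackets at the entries of \<open>B\<close> and closing brackets at those of \<open>A\<close>, the
  entry \<open>x\<close> is the first unmatched opening bracket, and \<open>step\<close> is a crystal operator for the
  commuting action of \<open>gl\<^bsub>2\<^esub>\<close> on the pair of columns. It is a bijection between successive levels
  (\<open>step_strict_bij\<close>).

  On the other hand, \<open>step\<close> is one outward slide. The slide starts below the right column; the hole
  rises there until the entry to the left of it is larger than the one above it. This is the entry
  \<open>x\<close>. It moves to the right, and the hole rises to the top of the left column. The inward slide into
  that place retraces this path. Both paths are dictated by semistandardness of the fillings before
  and after the slide (\<open>slides_cross_over\<close>, \<open>step_is_jdt_slide\<close>).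

  For \<open>p \<le> q\<close> the pairs with column lengths \<open>p\<close> and \<open>q\<close> whose walk is nonnegative are mapped by
  \<open>q - p\<close> steps bijectively onto the pairs with lengths \<open>q\<close> and \<open>p\<close> whose walk is minimal at its
  end. Both sets are generated by the highest weight element (\<open>cartan_pairs_generated\<close>), and the
  first one is by definition the crystal of tableaux with two columns. As the weight
  \<open>\<omega>\<^sub>p + \<omega>\<^sub>q\<close> occurs only once in the tensor product (\<open>hw_weight_unique\<close>), these sets are the Cartan
  components (\<open>cartan_component_eq\<close>), and a morphism between them is determined by its value at the
  highest weight element. So the Cartan braiding is the iterated step for \<open>p \<le> q\<close> and the inverse
  of an iterated step for \<open>p > q\<close> (\<open>cartan_braiding_eq\<close>).\<close>

section \<open>Isomorphisms of crystals given by plain functions\<close>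

definition closed_crystal :: "nat set \<Rightarrow> 'a crystal \<Rightarrow> bool" where
  "closed_crystal I A \<longleftrightarrow>
     (\<forall>x \<in> elems A. \<forall>i \<in> I. \<forall>y. Eop A i x = Some y \<or> Fop A i x = Some y \<longrightarrow> y \<in> elems A)"

definition commutes_with_ops ::
  "nat set \<Rightarrow> 'a crystal \<Rightarrow> 'b crystal \<Rightarrow> ('a \<Rightarrow> 'b) \<Rightarrow> bool" where
  "commutes_with_ops I A B h \<longleftrightarrow>
     (\<forall>x \<in> elems A. \<forall>i \<in> I.
        wt B (h x) i = wt A x i \<and>
        Eop B i (h x) = map_option h (Eop A i x) \<and>
        Fop B i (h x) = map_option h (Fop A i x))"

text \<open>The crystal isomorphisms below are all of this kind. Compared with \<open>crystal_iso\<close>, there is no zero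
  to keep track of, so they are easily composed and inverted, and the preservation of \<open>\<epsilon>\<^sub>i\<close> and \<open>\<phi>\<^sub>i\<close>
  need not be checked: it follows from commutation with the operators.\<close>

definition strict_bij :: "nat set \<Rightarrow> 'a crystal \<Rightarrow> 'b crystal \<Rightarrow> ('a \<Rightarrow> 'b) \<Rightarrow> bool" where
  "strict_bij I A B h \<longleftrightarrow>
     closed_crystal I A \<and> bij_betw h (elems A) (elems B) \<and> commutes_with_ops I A B h"

lemma closed_crystalD:
  assumes "closed_crystal I A" "x \<in> elems A" "i \<in> I"
  shows "Eop A i x = Some y \<Longrightarrow> y \<in> elems A" "Fop A i x = Some y \<Longrightarrow> y \<in> elems A"
  using assms by (auto simp only: closed_crystal_def)

lemma commutes_with_opsD:
  assumes "commutes_with_ops I A B h" "x \<in> elems A" "i \<in> I"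
  shows "wt B (h x) i = wt A x i" "Eop B i (h x) = map_option h (Eop A i x)"
    "Fop B i (h x) = map_option h (Fop A i x)"
  using assms by (auto simp: commutes_with_ops_def)

lemma strict_bij_image: "strict_bij I A B h \<Longrightarrow> x \<in> elems A \<Longrightarrow> h x \<in> elems B"
  by (auto simp: strict_bij_def bij_betw_def)

lemma strict_bij_surj: "strict_bij I A B h \<Longrightarrow> h ` elems A = elems B"
  by (simp add: strict_bij_def bij_betw_def)

lemma iter_op_simps [simp]:
  "iter_op h 0 b = Some b"
  "iter_op h (Suc k) b = Option.bind (iter_op h k b) h"
  by (simp_all add: iter_op_def)

lemma iter_op_transport:
  assumes "\<And>x. x \<in> X \<Longrightarrow> g (h x) = map_option h (f x)"
    and "\<And>x y. x \<in> X \<Longrightarrow> f x = Some y \<Longrightarrow> y \<in> X" and "x \<in> X"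
  shows "iter_op g k (h x) = map_option h (iter_op f k x) \<and>
         (\<forall>y. iter_op f k x = Some y \<longrightarrow> y \<in> X)"
proof (induction k)
  case (Suc k)
  then show ?case using assms by (cases "iter_op f k x") auto
qed (use assms in simp)

lemma eps_transport:
  assumes "closed_crystal I A" "commutes_with_ops I A B h" "x \<in> elems A" "i \<in> I"
  shows "eps B i (h x) = eps A i x"
proof -
  have "iter_op (Eop B i) k (h x) = map_option h (iter_op (Eop A i) k x)" for k
    by (rule iter_op_transport[THEN conjunct1, of "elems A"])
      (use assms in \<open>auto intro: closed_crystalD simp: commutes_with_opsD\<close>)
  then have "iter_op (Eop B i) k (h x) \<noteq> None \<longleftrightarrow> iter_op (Eop A i) k x \<noteq> None" for k
    by (simp only: option.map_disc_iff not_False_eq_True)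
  then show ?thesis unfolding eps_def by (simp only:)
qed

lemma phi_transport:
  assumes "closed_crystal I A" "commutes_with_ops I A B h" "x \<in> elems A" "i \<in> I"
  shows "phi B i (h x) = phi A i x"
proof -
  have "iter_op (Fop B i) k (h x) = map_option h (iter_op (Fop A i) k x)" for k
    by (rule iter_op_transport[THEN conjunct1, of "elems A"])
      (use assms in \<open>auto intro: closed_crystalD simp: commutes_with_opsD\<close>)
  then have "iter_op (Fop B i) k (h x) \<noteq> None \<longleftrightarrow> iter_op (Fop A i) k x \<noteq> None" for k
    by (simp only: option.map_disc_iff not_False_eq_True)
  then show ?thesis unfolding phi_def by (simp only:)
qed

lemma closed_crystal_target:
  assumes "strict_bij I A B h"
  shows "closed_crystal I B"
  unfolding closed_crystal_def
proof (intro ballI allI impI)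
  fix x i y assume x: "x \<in> elems B" and i: "i \<in> I" and y: "Eop B i x = Some y \<or> Fop B i x = Some y"
  obtain z where z: "z \<in> elems A" "x = h z"
    using x assms by (auto simp: strict_bij_def bij_betw_def)
  have cl: "closed_crystal I A" and co: "commutes_with_ops I A B h"
    using assms by (auto simp: strict_bij_def)
  have "\<exists>w \<in> elems A. y = h w"
    using y closed_crystalD[OF cl z(1) i] by (auto simp: z(2) commutes_with_opsD[OF co z(1) i])
  then show "y \<in> elems B" using assms by (auto simp: strict_bij_def bij_betw_def)
qed

lemma strict_bij_id:
  assumes "closed_crystal I A"
  shows "strict_bij I A A (\<lambda>x. x)"
  using assms
  by (auto simp: strict_bij_def commutes_with_ops_def option.map_ident bij_betw_def)

lemma strict_bij_comp:
  assumes "strict_bij I A B h" "strict_bij I B C g"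
  shows "strict_bij I A C (g \<circ> h)"
  unfolding strict_bij_def
proof (intro conjI)
  show "closed_crystal I A" using assms by (simp add: strict_bij_def)
  show "bij_betw (g \<circ> h) (elems A) (elems C)"
    using assms bij_betw_trans unfolding strict_bij_def by blast
  show "commutes_with_ops I A C (g \<circ> h)"
    using assms strict_bij_image[OF assms(1)]
    by (auto simp: strict_bij_def commutes_with_ops_def option.map_comp)
qed

lemma strict_bij_inv:
  assumes "strict_bij I A B h"
  shows "strict_bij I B A (inv_into (elems A) h)"
proof -
  let ?g = "inv_into (elems A) h"
  have b: "bij_betw h (elems A) (elems B)" and cl: "closed_crystal I A"
    and co: "commutes_with_ops I A B h" using assms by (auto simp: strict_bij_def)
  have gh: "?g (h x) = x" if "x \<in> elems A" for x
    using b that by (auto simp: bij_betw_def)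
  have undo: "map_option ?g (map_option h s) = s" if "\<And>y. s = Some y \<Longrightarrow> y \<in> elems A" for s
    using gh that by (cases s) auto
  have "commutes_with_ops I B A ?g"
    unfolding commutes_with_ops_def
  proof (intro ballI)
    fix x i assume x: "x \<in> elems B" and i: "i \<in> I"
    obtain z where z: "z \<in> elems A" "x = h z"
      using x b by (auto simp: bij_betw_def)
    have "wt B (h z) i = wt A z i"
      "Eop B i (h z) = map_option h (Eop A i z)" "Fop B i (h z) = map_option h (Fop A i z)"
      using co z i by (auto simp: commutes_with_ops_def)
    then show "wt A (?g x) i = wt B x i \<and> Eop A i (?g x) = map_option ?g (Eop B i x) \<and>
        Fop A i (?g x) = map_option ?g (Fop B i x)"
      using gh[OF z(1)] z undo[OF closed_crystalD(1)[OF cl z(1) i]]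
        undo[OF closed_crystalD(2)[OF cl z(1) i]] by simp
  qed
  then show ?thesis
    using closed_crystal_target[OF assms] b
    by (simp add: strict_bij_def bij_betw_inv_into)
qed

lemma subcrystal_simps [simp]:
  "elems (subcrystal A S) = S" "wt (subcrystal A S) = wt A"
  "Eop (subcrystal A S) = Eop A" "Fop (subcrystal A S) = Fop A"
  "eps (subcrystal A S) = eps A" "phi (subcrystal A S) = phi A"
  by (simp_all add: subcrystal_def eps_def phi_def fun_eq_iff)

text \<open>Extended by zero, a function that commutes with the operators is still a morphism when its
  domain is a union of components: then no operator leads from outside into the domain.\<close>

lemma crystal_morphism_extend_by_zero:
  assumes closed: "closed_crystal I (subcrystal A S)" and h: "commutes_with_ops I (subcrystal A S) B h"
    and im: "\<And>x. x \<in> S \<Longrightarrow> h x \<in> elems B"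
    and out: "\<And>x i y. x \<in> elems A \<Longrightarrow> i \<in> I \<Longrightarrow> Eop A i x = Some y \<or> Fop A i x = Some y \<Longrightarrow>
                y \<in> S \<Longrightarrow> x \<in> S"
  shows "crystal_morphism I A B (\<lambda>x. if x \<in> S then Some (h x) else None)"
    (is "crystal_morphism I A B ?\<psi>")
proof -
  have inside: "Option.bind s ?\<psi> = map_option h s" if "\<And>y. s = Some y \<Longrightarrow> y \<in> S" for s
    using that by (cases s) auto
  have outside: "Option.bind s ?\<psi> = None" if "\<And>y. s = Some y \<Longrightarrow> y \<notin> S" for s
    using that by (cases s) auto
  show ?thesis
    unfolding crystal_morphism_def
  proof (rule conjI; intro ballI allI impI)
    fix x y assume "x \<in> elems A" "?\<psi> x = Some y"
    then have "x \<in> S" "y = h x" by (auto split: if_splits)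
    then show "y \<in> elems B \<and> (\<forall>i\<in>I. wt B y i = wt A x i \<and> eps B i y = eps A i x \<and> phi B i y = phi A i x)"
      using im eps_transport[OF closed h, of x] phi_transport[OF closed h, of x]
        commutes_with_opsD[OF h, of x] by auto
  next
    fix x i assume x: "x \<in> elems A" and i: "i \<in> I"
    show "Option.bind (Eop A i x) ?\<psi> = Option.bind (?\<psi> x) (Eop B i) \<and>
        Option.bind (Fop A i x) ?\<psi> = Option.bind (?\<psi> x) (Fop B i)"
    proof (cases "x \<in> S")
      case True
      then show ?thesis
        using closed_crystalD[OF closed _ i, of x] commutes_with_opsD[OF h _ i, of x]
        by (simp add: inside)
    next
      case False
      then have "Option.bind (Eop A i x) ?\<psi> = None" "Option.bind (Fop A i x) ?\<psi> = None"
        using out[OF x i] by (auto intro!: outside)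
      then show ?thesis using False by simp
    qed
  qed
qed

lemma crystal_iso_of_strict_bij:
  assumes "strict_bij I A B h"
  shows "crystal_iso I A B (\<lambda>x. if x \<in> elems A then Some (h x) else None)"
proof -
  have A: "subcrystal A (elems A) = A" by (simp add: subcrystal_def)
  have "bij_betw (\<lambda>x. the (if x \<in> elems A then Some (h x) else None)) (elems A) (elems B)"
    using assms by (simp add: strict_bij_def cong: bij_betw_cong)
  moreover have "crystal_morphism I A B (\<lambda>x. if x \<in> elems A then Some (h x) else None)"
    using crystal_morphism_extend_by_zero[of I A "elems A" B h] assms A strict_bij_image[OF assms]
    by (auto simp: strict_bij_def)
  ultimately show ?thesis by (simp add: crystal_iso_def)
qed

lemma crystal_isoD:
  assumes "crystal_iso I A B \<psi>" "x \<in> elems A"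
  shows "\<exists>y \<in> elems B. \<psi> x = Some y \<and> (\<forall>i \<in> I. wt B y i = wt A x i)"
proof -
  obtain y where "\<psi> x = Some y" using assms unfolding crystal_iso_def by blast
  then show ?thesis using assms unfolding crystal_iso_def crystal_morphism_def by blast
qed

section \<open>Crystals generated by one element\<close>

definition generated_by :: "nat set \<Rightarrow> 'a crystal \<Rightarrow> 'a \<Rightarrow> bool" where
  "generated_by I A u \<longleftrightarrow> u \<in> elems A \<and> (\<forall>x \<in> elems A. (u, x) \<in> (crystal_graph I A)\<^sup>*)"

text \<open>The axiom that makes \<open>E\<^sub>i\<close> and \<open>F\<^sub>i\<close> partial inverses of each other. It does not hold for arbitrary
  records of type \<open>crystal\<close>, and it is needed to follow an edge of the crystal graph backwards.\<close>

definition normal_ops :: "nat set \<Rightarrow> 'a crystal \<Rightarrow> bool" where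
  "normal_ops I A \<longleftrightarrow>
     (\<forall>x \<in> elems A. \<forall>i \<in> I. \<forall>y. (Fop A i x = Some y \<longrightarrow> Eop A i y = Some x) \<and>
                                (Eop A i x = Some y \<longrightarrow> Fop A i y = Some x))"

lemma normal_opsD:
  assumes "normal_ops I A" "x \<in> elems A" "i \<in> I"
  shows "Fop A i x = Some y \<Longrightarrow> Eop A i y = Some x" "Eop A i x = Some y \<Longrightarrow> Fop A i y = Some x"
  using assms unfolding normal_ops_def by blast+

lemma generated_by_transport:
  assumes "strict_bij I A B h" "generated_by I A u"
  shows "generated_by I B (h u)"
proof -
  have co: "commutes_with_ops I A B h" and b: "bij_betw h (elems A) (elems B)"
    using assms(1) by (auto simp: strict_bij_def)
  have edge: "(h x, h y) \<in> crystal_graph I B" if "(x, y) \<in> crystal_graph I A" for x y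
    using that strict_bij_image[OF assms(1)] commutes_with_opsD[OF co]
    by (fastforce simp: crystal_graph_def)
  have path: "(h u, h x) \<in> (crystal_graph I B)\<^sup>*" if "(u, x) \<in> (crystal_graph I A)\<^sup>*" for x
    using that by (induction rule: rtrancl_induct) (auto intro: edge rtrancl_into_rtrancl)
  have "elems B = h ` elems A" using b by (simp add: bij_betw_def)
  then show ?thesis
    using path assms(2) by (auto simp: generated_by_def)
qed

lemma normal_ops_transport:
  assumes "strict_bij I A B h" "normal_ops I A"
  shows "normal_ops I B"
  unfolding normal_ops_def
proof (intro ballI allI)
  fix x i y assume x: "x \<in> elems B" and i: "i \<in> I"
  have cl: "closed_crystal I A" and co: "commutes_with_ops I A B h"
    using assms(1) by (auto simp: strict_bij_def)
  obtain z where z: "z \<in> elems A" "x = h z"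
    using x assms(1) by (auto simp: strict_bij_def bij_betw_def)
  note zi = closed_crystalD[OF cl z(1) i] commutes_with_opsD[OF co z(1) i]
  have n: "Fop A i z = Some w \<Longrightarrow> Eop A i w = Some z" "Eop A i z = Some w \<Longrightarrow> Fop A i w = Some z" for w
    by (fact normal_opsD[OF assms(2) z(1) i])+
  show "(Fop B i x = Some y \<longrightarrow> Eop B i y = Some x) \<and> (Eop B i x = Some y \<longrightarrow> Fop B i y = Some x)"
    using zi n commutes_with_opsD[OF co _ i] by (auto simp: z(2))
qed

text \<open>By normality a backward edge is an edge of \<open>E\<^sub>i\<close>, so a set that is stable under all operators
  cannot be left through the graph in either direction.\<close>

lemma generated_stable_set_is_component:
  assumes sub: "S \<subseteq> elems A" and closed: "closed_crystal I (subcrystal A S)"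
    and normal: "normal_ops I A" and gen: "generated_by I (subcrystal A S) u"
  shows "S = (crystal_graph I A \<union> (crystal_graph I A)\<inverse>)\<^sup>* `` {u}"
    and "S \<in> connected_components I A"
proof -
  let ?R = "crystal_graph I A \<union> (crystal_graph I A)\<inverse>"
  have u: "u \<in> S" using gen by (simp add: generated_by_def)
  have "y \<in> S" if "(u, y) \<in> ?R\<^sup>*" for y
    using that
  proof (induction rule: rtrancl_induct)
    case (step y z)
    then consider i where "i \<in> I" "Fop A i y = Some z" | i where "i \<in> I" "z \<in> elems A" "Fop A i z = Some y"
      by (auto simp: crystal_graph_def)
    then show ?case
    proof cases
      case 1
      then show ?thesis using closed_crystalD(2)[OF closed, of y i z] step by simp
    next
      case 2
      then have "Eop A i y = Some z" by (intro normal_opsD(1)[OF normal])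
      then show ?thesis using closed_crystalD(1)[OF closed, of y i z] step 2 by simp
    qed
  qed (rule u)
  moreover have "crystal_graph I (subcrystal A S) \<subseteq> ?R"
    using sub by (auto simp: crystal_graph_def)
  then have "(u, y) \<in> ?R\<^sup>*" if "y \<in> S" for y
    using gen that rtrancl_mono[of "crystal_graph I (subcrystal A S)" ?R]
    unfolding generated_by_def subcrystal_simps by blast
  ultimately show eq: "S = ?R\<^sup>* `` {u}" by auto
  show "S \<in> connected_components I A"
    unfolding connected_components_def eq using u sub by (intro quotientI) blast
qed

text \<open>Identifies a component that is only known through one of its elements: this is how the component
  that contains the highest weight element will be recognised.\<close>

lemma component_containing:
  assumes "C \<in> connected_components I A" "u \<in> C"
  shows "C = (crystal_graph I A \<union> (crystal_graph I A)\<inverse>)\<^sup>* `` {u}"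
proof -
  let ?R = "crystal_graph I A \<union> (crystal_graph I A)\<inverse>"
  have "sym ?R" by (auto simp: sym_def)
  then have "equiv UNIV (?R\<^sup>*)"
    by (intro equivI) (auto simp: refl_on_def sym_rtrancl trans_rtrancl)
  moreover obtain x where "C = ?R\<^sup>* `` {x}"
    using assms(1) by (auto simp: connected_components_def elim: quotientE)
  ultimately show ?thesis using assms(2) equiv_class_eq[of UNIV "?R\<^sup>*" x u] by auto
qed

lemma component_subset:
  assumes "C \<in> connected_components I A"
  shows "C \<subseteq> elems A"
proof
  fix y assume "y \<in> C"
  then obtain x where x: "x \<in> elems A" "(x, y) \<in> (crystal_graph I A \<union> (crystal_graph I A)\<inverse>)\<^sup>*"
    using assms unfolding connected_components_def quotient_def by blast
  have "(crystal_graph I A \<union> (crystal_graph I A)\<inverse>) `` elems A \<subseteq> elems A"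
    by (auto simp: crystal_graph_def)
  then show "y \<in> elems A" using Image_closed_trancl x by blast
qed

text \<open>Commutation with the \<open>F\<^sub>i\<close> propagates the value at the generator along every path. This gives the
  uniqueness of the braiding.\<close>

lemma morphisms_agree_on_generated:
  assumes gen: "generated_by I (subcrystal A S) u" and sub: "S \<subseteq> elems A"
    and \<sigma>: "crystal_morphism I A B \<sigma>" and \<tau>: "crystal_morphism I A B \<tau>"
    and u: "\<sigma> u = \<tau> u" and x: "x \<in> S"
  shows "\<sigma> x = \<tau> x"
proof -
  have "(u, x) \<in> (crystal_graph I (subcrystal A S))\<^sup>*"
    using gen x by (simp add: generated_by_def)
  then show ?thesis
  proof (induction rule: rtrancl_induct)
    case (step y z)
    then obtain i where i: "i \<in> I" "y \<in> elems A" "Fop A i y = Some z"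
      using sub by (auto simp: crystal_graph_def)
    have "Option.bind (Fop A i y) \<rho> = Option.bind (\<rho> y) (Fop B i)" if "crystal_morphism I A B \<rho>" for \<rho>
      using that i(1,2) unfolding crystal_morphism_def by blast
    from this[OF \<sigma>] this[OF \<tau>] step.IH show ?case by (simp add: i(3))
  qed (rule u)
qed

section \<open>The crystal of pairs of sets\<close>

text \<open>The tensor product rule for two columns, in terms of their sets of entries: for a column \<open>A\<close> the
  number \<open>\<phi>\<^sub>k\<close> is \<open>1\<close> if \<open>k \<in> A\<close> and \<open>k + 1 \<notin> A\<close>, and \<open>0\<close> otherwise, and \<open>\<epsilon>\<^sub>k\<close> likewise with \<open>k\<close>
  and \<open>k + 1\<close> exchanged. The first component is the left tensor factor, which is the right column
  of the tableau.\<close>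

definition pairE :: "nat \<Rightarrow> nat set \<times> nat set \<Rightarrow> (nat set \<times> nat set) option" where
  "pairE k = (\<lambda>(A, B).
     if Suc k \<in> B \<and> k \<notin> B \<and> \<not> (k \<in> A \<and> Suc k \<notin> A) then Some (A, insert k (B - {Suc k}))
     else if Suc k \<in> A \<and> k \<notin> A
       then Some (insert k (A - {Suc k}), B)
     else None)"

definition pairF :: "nat \<Rightarrow> nat set \<times> nat set \<Rightarrow> (nat set \<times> nat set) option" where
  "pairF k = (\<lambda>(A, B).
     if k \<in> A \<and> Suc k \<notin> A \<and> \<not> (Suc k \<in> B \<and> k \<notin> B) then Some (insert (Suc k) (A - {k}), B)
     else if k \<in> B \<and> Suc k \<notin> B
       then Some (A, insert (Suc k) (B - {k}))
     else None)"

definition content :: "nat set \<times> nat set \<Rightarrow> nat \<Rightarrow> int" where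
  "content = (\<lambda>(A, B) v. of_bool (v \<in> A) + of_bool (v \<in> B))"

definition pair_crystal :: "(nat set \<times> nat set) set \<Rightarrow> (nat set \<times> nat set) crystal" where
  "pair_crystal X = \<lparr>elems = X, wt = (\<lambda>z k. content z k - content z (Suc k)), Eop = pairE, Fop = pairF\<rparr>"

lemma pair_crystal_simps [simp]:
  "elems (pair_crystal X) = X" "wt (pair_crystal X) z k = content z k - content z (Suc k)"
  "Eop (pair_crystal X) = pairE" "Fop (pair_crystal X) = pairF"
  by (simp_all add: pair_crystal_def)

lemma pairF_iff_pairE: "pairF k z = Some w \<longleftrightarrow> pairE k w = Some z"
proof -
  obtain A B C D where "z = (A, B)" "w = (C, D)" by (metis surj_pair)
  then show ?thesis by (auto simp: pairE_def pairF_def split: if_splits)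
qed

definition excess :: "nat set \<times> nat set \<Rightarrow> nat \<Rightarrow> int" where
  "excess = (\<lambda>(A, B) v. int (card (B \<inter> {1..v})) - int (card (A \<inter> {1..v})))"

lemma card_Int_Suc: "card (A \<inter> {1..Suc v}) = card (A \<inter> {1..v}) + of_bool (Suc v \<in> A)"
proof -
  have "A \<inter> {1..Suc v} = (if Suc v \<in> A then insert (Suc v) (A \<inter> {1..v}) else A \<inter> {1..v})"
    by (auto simp: le_Suc_eq)
  then show ?thesis by simp
qed

lemma excess_0 [simp]: "excess z 0 = 0"
  by (simp add: excess_def split: prod.split)

lemma excess_Suc:
  "excess (A, B) (Suc v) = excess (A, B) v + of_bool (Suc v \<in> B) - of_bool (Suc v \<in> A)"
  by (simp add: excess_def card_Int_Suc del: One_nat_def)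

lemma card_Int_shift:
  assumes "k \<in> A" "Suc k \<notin> A" "1 \<le> k"
  shows "int (card (insert (Suc k) (A - {k}) \<inter> {1..v})) = int (card (A \<inter> {1..v})) - of_bool (v = k)"
proof (induction v)
  case (Suc v)
  then show ?case using assms unfolding card_Int_Suc by auto
qed (use assms in auto)

lemma excess_shift:
  assumes "k \<in> C" "Suc k \<notin> C" "1 \<le> k"
  shows "excess (insert (Suc k) (C - {k}), B) v = excess (C, B) v + of_bool (v = k)"
    and "excess (A, insert (Suc k) (C - {k})) v = excess (A, C) v - of_bool (v = k)"
  using card_Int_shift[OF assms] by (simp_all add: excess_def)

text \<open>The tensor product rule makes the walk move by one at \<open>k\<close> in such a way that neither the old nor
  the new value at \<open>k\<close> is below both neighbours: an \<open>F\<^sub>k\<close> acting on \<open>A\<close> raises the value at \<open>k\<close>,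
  which was not a strict local minimum because the pair \<open>k\<close>, \<open>k + 1\<close> is not of the form
  down, up; an \<open>F\<^sub>k\<close> acting on \<open>B\<close> lowers a value that exceeds one of its neighbours.\<close>

lemma excess_pairF:
  assumes "pairF k z = Some w" "1 \<le> k"
  shows "v \<noteq> k \<Longrightarrow> excess w v = excess z v"
    and "\<exists>u \<in> {k - 1, Suc k}. excess z u \<le> excess z k \<and> excess z u \<le> excess w k"
proof -
  obtain A B where z: "z = (A, B)" by (metis surj_pair)
  have k: "excess z k = excess z (k - 1) + of_bool (k \<in> B) - of_bool (k \<in> A)"
    using excess_Suc[of A B "k - 1"] assms(2) by (simp add: z)
  note k' = excess_Suc[of A B k]
  consider
    (A) "k \<in> A" "Suc k \<notin> A" "Suc k \<in> B \<Longrightarrow> k \<in> B" "w = (insert (Suc k) (A - {k}), B)" |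
    (B) "k \<in> A \<Longrightarrow> Suc k \<in> A" "k \<in> B" "Suc k \<notin> B" "w = (A, insert (Suc k) (B - {k}))"
    using assms(1) by (auto simp: z pairF_def split: if_splits)
  then have "(v \<noteq> k \<longrightarrow> excess w v = excess z v) \<and>
      (\<exists>u \<in> {k - 1, Suc k}. excess z u \<le> excess z k \<and> excess z u \<le> excess w k)"
  proof cases
    case A
    then show ?thesis using excess_shift(1)[OF A(1,2) assms(2)] k k' by (auto simp: z)
  next
    case B
    then show ?thesis using excess_shift(2)[OF B(2,3) assms(2)] k k' by (auto simp: z)
  qed
  then show "v \<noteq> k \<Longrightarrow> excess w v = excess z v"
    and "\<exists>u \<in> {k - 1, Suc k}. excess z u \<le> excess z k \<and> excess z u \<le> excess w k" by auto
qed

lemma excess_pair_op: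
  assumes "pairF k z = Some w \<or> pairE k z = Some w" "1 \<le> k"
  shows "v \<noteq> k \<Longrightarrow> excess w v = excess z v"
    and "\<exists>u \<in> {k - 1, Suc k}. excess z u \<le> excess z k \<and> excess z u \<le> excess w k"
proof -
  have u: "k - 1 \<noteq> k" "Suc k \<noteq> k" using assms(2) by auto
  have "pairF k z = Some w \<or> pairF k w = Some z" using assms(1) pairF_iff_pairE by blast
  then show "v \<noteq> k \<Longrightarrow> excess w v = excess z v"
    and "\<exists>u \<in> {k - 1, Suc k}. excess z u \<le> excess z k \<and> excess z u \<le> excess w k"
    using excess_pairF[of k z w] excess_pairF[of k w z] assms(2) u by auto
qed

definition min_excess :: "nat set \<times> nat set \<Rightarrow> int \<Rightarrow> bool" where
  "min_excess z m \<longleftrightarrow> (\<forall>v. m \<le> excess z v) \<and> (\<exists>v. excess z v = m)"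

text \<open>A neighbour of \<open>k\<close>, where the walk does not change, attains a value at least as small as both
  values at \<open>k\<close>.\<close>

lemma min_excess_pair_op:
  assumes "min_excess z m" "pairF k z = Some w \<or> pairE k z = Some w" "1 \<le> k"
  shows "min_excess w m"
proof -
  obtain u where u': "u = k - 1 \<or> u = Suc k" and u: "excess z u \<le> excess z k" "excess z u \<le> excess w k"
    using excess_pair_op(2)[OF assms(2,3)] by auto
  have "u \<noteq> k" using u' assms(3) by auto
  note same = excess_pair_op(1)[OF assms(2,3)]
  have low: "m \<le> excess z v" for v using assms(1) by (simp add: min_excess_def)
  obtain v where v: "excess z v = m" using assms(1) by (auto simp: min_excess_def)
  have "m \<le> excess w v" for v
    using same[of v] low[of v] low[of u] u(2) by (cases "v = k") auto
  moreover have "excess w (if v = k then u else v) = m"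
    using same[of v] same[of u] v \<open>u \<noteq> k\<close> u(1) low[of u] by auto
  ultimately show ?thesis unfolding min_excess_def by blast
qed

section \<open>Transferring an entry\<close>

text \<open>The point \<open>x\<close> follows the last minimum of the walk. Equivalently, it is the smallest entry of \<open>B\<close>
  that remains unmatched when every entry \<open>a\<close> of \<open>A\<close>, in increasing order, is matched with the
  largest entry of \<open>B\<close> that is at most \<open>a\<close> and still free.\<close>

definition crossing :: "nat set \<times> nat set \<Rightarrow> nat \<Rightarrow> bool" where
  "crossing z x \<longleftrightarrow>
     1 \<le> x \<and> (\<forall>v. excess z (x - 1) \<le> excess z v) \<and> (\<forall>v \<ge> x. excess z (x - 1) < excess z v)"

definition transfer :: "nat \<Rightarrow> nat set \<times> nat set \<Rightarrow> nat set \<times> nat set" where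
  "transfer x = (\<lambda>(A, B). (insert x A, B - {x}))"

lemma crossing_unique:
  assumes "crossing z x" "crossing z y"
  shows "x = y"
proof -
  have "\<not> a < b" if "crossing z a" "crossing z b" for a b
  proof
    assume "a < b"
    then have "excess z (a - 1) < excess z (b - 1)" using that(1) by (simp add: crossing_def)
    moreover have "excess z (b - 1) \<le> excess z (a - 1)" using that(2) by (simp add: crossing_def)
    ultimately show False by simp
  qed
  then show ?thesis using assms by (meson linorder_neqE_nat)
qed

lemma crossing_mem:
  assumes "crossing (A, B) x"
  shows "x \<in> B" "x \<notin> A" "1 \<le> x"
proof -
  have "1 \<le> x" "excess (A, B) (x - 1) < excess (A, B) x" using assms by (auto simp: crossing_def)
  then show "x \<in> B" "x \<notin> A" "1 \<le> x"
    using excess_Suc[of A B "x - 1"] by (auto split: if_splits)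
qed

lemma crossing_exists:
  assumes "min_excess z m" and large: "\<And>v. v \<ge> N \<Longrightarrow> m < excess z v"
  shows "\<exists>x. crossing z x \<and> excess z (x - 1) = m"
proof -
  let ?V = "{v. excess z v = m}"
  have "v \<le> N" if "excess z v = m" for v
    using large[of v] that by (cases "v \<le> N") auto
  then have "?V \<subseteq> {..N}" by auto
  then have fin: "finite ?V" by (rule finite_subset) simp
  have ne: "?V \<noteq> {}" using assms(1) by (auto simp: min_excess_def)
  have "excess z (Max ?V) = m" using Max_in[OF fin ne] by simp
  moreover have "m < excess z v" if "Max ?V < v" for v
  proof -
    have "v \<notin> ?V" using that Max_ge[OF fin, of v] by auto
    then show ?thesis using assms(1) by (auto simp: min_excess_def less_le)
  qed
  ultimately have "crossing z (Suc (Max ?V))" "excess z (Suc (Max ?V) - 1) = m"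
    using assms(1) by (auto simp: crossing_def min_excess_def)
  then show ?thesis by blast
qed

text \<open>Away from \<open>k\<close> and \<open>k + 1\<close> the last minimum stays where it is, since the value at \<open>k\<close> is bounded
  below by that of a neighbour on the same side of \<open>x\<close>.\<close>

lemma crossing_pair_op:
  assumes "crossing z x" "pairF k z = Some w \<or> pairE k z = Some w" "1 \<le> k" "x \<noteq> k" "x \<noteq> Suc k"
  shows "crossing w x"
proof -
  obtain u where u: "u = k - 1 \<or> u = Suc k" "excess z u \<le> excess w k"
    using excess_pair_op(2)[OF assms(2,3)] by auto
  note same = excess_pair_op(1)[OF assms(2,3)]
  have x: "1 \<le> x" and low: "\<And>v. excess z (x - 1) \<le> excess z v"
    and high: "\<And>v. x \<le> v \<Longrightarrow> excess z (x - 1) < excess z v" using assms(1) by (auto simp: crossing_def)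
  have base: "excess w (x - 1) = excess z (x - 1)" using same x assms(5) by auto
  have "excess z (x - 1) \<le> excess w v" for v
    using same[of v] low[of v] low[of u] u(2) by (cases "v = k") auto
  moreover have "excess z (x - 1) < excess w v" if "x \<le> v" for v
  proof (cases "v = k")
    case True
    then have "x \<le> u" using u(1) that assms(4) by auto
    then show ?thesis using high[of u] u(2) True by auto
  next
    case False
    then show ?thesis using same[of v] high[OF that] by simp
  qed
  ultimately show ?thesis using x base by (simp add: crossing_def)
qed

text \<open>The point \<open>x\<close> is affected only in two situations. If \<open>F\<^sub>k\<close> acts on \<open>A\<close> and \<open>x = k + 1\<close>, then after
  the transfer it acts on \<open>B\<close>, and the last minimum has moved from \<open>k\<close> to \<open>k - 1\<close>. If \<open>F\<^sub>k\<close> acts on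
  \<open>B\<close> and \<open>x = k\<close>, then after the transfer it acts on \<open>A\<close>, and the last minimum has moved from
  \<open>k - 1\<close> to \<open>k\<close>.\<close>

lemma pairF_transfer_Some:
  assumes x: "crossing z x" and w: "pairF k z = Some w" and k: "1 \<le> k"
  shows "\<exists>y. crossing w y \<and> pairF k (transfer x z) = Some (transfer y w)"
proof -
  obtain A B where z: "z = (A, B)" by (metis surj_pair)
  note mem = crossing_mem[OF x[unfolded z]]
  have low: "\<And>v. excess z (x - 1) \<le> excess z v"
    and high: "\<And>v. x \<le> v \<Longrightarrow> excess z (x - 1) < excess z v" using x by (auto simp: crossing_def)
  have ek: "excess z k = excess z (k - 1) + of_bool (k \<in> B) - of_bool (k \<in> A)"
    using excess_Suc[of A B "k - 1"] k by (simp add: z)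
  note ek' = excess_Suc[of A B k, folded z]
  consider
    (A) "k \<in> A" "Suc k \<notin> A" "Suc k \<in> B \<Longrightarrow> k \<in> B" "w = (insert (Suc k) (A - {k}), B)" |
    (B) "k \<in> A \<Longrightarrow> Suc k \<in> A" "k \<in> B" "Suc k \<notin> B" "w = (A, insert (Suc k) (B - {k}))"
    using w by (auto simp: z pairF_def split: if_splits)
  then show ?thesis
  proof cases
    case A
    note ew = excess_shift(1)[OF A(1,2) k, of B, folded A(4) z]
    show ?thesis
    proof (cases "x = Suc k")
      case True
      then have "excess z (k - 1) = excess z k" using ek A mem by simp
      then have low': "excess z (k - 1) \<le> excess z v" and high': "k < v \<Longrightarrow> excess z (k - 1) < excess z v" for v
        using low[of v] high[of v] True by auto
      have "excess w (k - 1) = excess z (k - 1)" using k by (simp add: ew)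
      moreover have "excess z (k - 1) < excess w v" if "k \<le> v" for v
        using low'[of v] high'[of v] that by (cases "v = k") (auto simp: ew)
      moreover have "excess z (k - 1) \<le> excess w v" for v
        using low'[of v] by (cases "v = k") (auto simp: ew)
      ultimately have "crossing w k" unfolding crossing_def using k by simp
      moreover have "pairF k (transfer x z) = Some (transfer k w)"
        using True A mem by (auto simp: z transfer_def pairF_def)
      ultimately show ?thesis by blast
    next
      case False
      moreover have "x \<noteq> k" using A mem by auto
      ultimately have "crossing w x" using crossing_pair_op[of z x k w] x w k by blast
      moreover have "pairF k (transfer x z) = Some (transfer x w)"
        using False \<open>x \<noteq> k\<close> A mem by (auto simp: z transfer_def pairF_def)
      ultimately show ?thesis by blast
    qed
  next
    case B
    note ew = excess_shift(2)[OF B(2,3) k, of A, folded B(4) z]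
    show ?thesis
    proof (cases "x = k")
      case True
      then have up: "excess z k = excess z (k - 1) + 1" using ek B mem by simp
      then have "Suc k \<notin> A" using high[of "Suc k"] ek' B True by (auto split: if_splits)
      moreover have "crossing w (Suc k)"
        unfolding crossing_def using k low high[unfolded True] up True 
        by (auto simp: ew)
      moreover have "pairF k (transfer x z) = Some (transfer (Suc k) w)"
        using True B mem \<open>Suc k \<notin> A\<close> by (auto simp: z transfer_def pairF_def)
      ultimately show ?thesis by blast
    next
      case False
      moreover have "x \<noteq> Suc k" using B mem by auto
      ultimately have "crossing w x" using crossing_pair_op[of z x k w] x w k by blast
      moreover have "pairF k (transfer x z) = Some (transfer x w)"
        using False \<open>x \<noteq> Suc k\<close> B mem by (auto simp: z transfer_def pairF_def)
      ultimately show ?thesis by blast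
    qed
  qed
qed

lemma pair_op_None_iff:
  "pairF k (A, B) = None \<longleftrightarrow>
     (k \<in> A \<longrightarrow> Suc k \<in> A \<or> Suc k \<in> B \<and> k \<notin> B) \<and> (k \<in> B \<longrightarrow> Suc k \<in> B)"
  "pairE k (A, B) = None \<longleftrightarrow>
     (Suc k \<in> B \<longrightarrow> k \<in> B \<or> k \<in> A \<and> Suc k \<notin> A) \<and> (Suc k \<in> A \<longrightarrow> k \<in> A)"
  by (auto simp: pairF_def pairE_def)

lemma pair_op_transfer_None:
  assumes x: "crossing z x" and k: "1 \<le> k"
  shows "pairF k z = None \<Longrightarrow> pairF k (transfer x z) = None"
    and "pairE k z = None \<Longrightarrow> pairE k (transfer x z) = None"
proof -
  obtain A B where z: "z = (A, B)" by (metis surj_pair)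
  note mem = crossing_mem[OF x[unfolded z]]
  \<comment> \<open>A minimum at \<open>k\<close> cannot be reached by an up step.\<close>
  have no_ascent: "k \<in> A" if "x = Suc k" "k \<in> B"
  proof (rule ccontr)
    assume "k \<notin> A"
    then have "excess z k = excess z (k - 1) + 1"
      using excess_Suc[of A B "k - 1"] k that(2) by (simp add: z)
    moreover have "excess z k \<le> excess z (k - 1)" using x that(1) by (simp add: crossing_def)
    ultimately show False by simp
  qed
  consider "x = k" | "x = Suc k" "k \<in> B \<longrightarrow> k \<in> A" | "x \<noteq> k" "x \<noteq> Suc k"
    using no_ascent by blast
  then have "(pairF k z = None \<longrightarrow> pairF k (transfer x z) = None) \<and>
      (pairE k z = None \<longrightarrow> pairE k (transfer x z) = None)"
    unfolding z transfer_def case_prod_conv pair_op_None_iff using mem by cases auto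
  then show "pairF k z = None \<Longrightarrow> pairF k (transfer x z) = None"
    and "pairE k z = None \<Longrightarrow> pairE k (transfer x z) = None" by blast+
qed

lemma excess_transfer:
  assumes "x \<in> B" "x \<notin> A" "1 \<le> x"
  shows "excess (transfer x (A, B)) v = excess (A, B) v - 2 * of_bool (x \<le> v)"
proof (induction v)
  case (Suc v)
  then show ?case using assms by (auto simp: transfer_def excess_Suc le_Suc_eq)
qed (use assms in simp)

definition pairs :: "nat \<Rightarrow> nat \<Rightarrow> nat \<Rightarrow> (nat set \<times> nat set) set" where
  "pairs r p q = {(A, B). A \<subseteq> {1..r + 1} \<and> B \<subseteq> {1..r + 1} \<and> card A = p \<and> card B = q}"

text \<open>The level sets of the minimum of the walk are stable under the crystal operators; \<open>step\<close> leads from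
  one level to the next lower one.\<close>

definition level :: "nat \<Rightarrow> nat \<Rightarrow> nat \<Rightarrow> int \<Rightarrow> (nat set \<times> nat set) set" where
  "level r p q m = {z \<in> pairs r p q. min_excess z m}"

lemma pairs_finite: "(A, B) \<in> pairs r p q \<Longrightarrow> finite A \<and> finite B"
  by (auto simp: pairs_def intro: finite_subset)

lemma excess_total:
  assumes "z \<in> pairs r p q" "r + 1 \<le> v"
  shows "excess z v = int q - int p"
proof -
  obtain A B where z: "z = (A, B)" "A \<subseteq> {1..r + 1}" "B \<subseteq> {1..r + 1}" "card A = p" "card B = q"
    using assms(1) by (auto simp: pairs_def)
  then have "A \<inter> {1..v} = A" "B \<inter> {1..v} = B" using assms(2) by fastforce+
  then show ?thesis using z by (simp add: excess_def)
qed

lemma card_swap_element: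
  assumes "finite A" "a \<in> A" "b \<notin> A"
  shows "card (insert b (A - {a})) = card A"
  using assms by (metis Diff_iff card.insert_remove card_insert_disjoint card_Suc_Diff1 finite_Diff)

lemma pair_op_pairs:
  assumes "z \<in> pairs r p q" "k \<in> {1..r}" "pairE k z = Some w \<or> pairF k z = Some w"
  shows "w \<in> pairs r p q"
proof -
  obtain A B where z: "z = (A, B)" by (metis surj_pair)
  have fin: "finite A" "finite B" using assms(1) pairs_finite z by blast+
  show ?thesis
    using assms fin
    by (auto simp: z pairs_def pairE_def pairF_def card_swap_element
        simp del: card_Diff_singleton card_insert_disjoint split: if_splits)
qed

lemma closed_pairs: "closed_crystal {1..r} (pair_crystal (pairs r p q))"
  using pair_op_pairs unfolding closed_crystal_def by simp

lemma pair_op_level: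
  assumes "z \<in> level r p q m" "k \<in> {1..r}" "pairE k z = Some w \<or> pairF k z = Some w"
  shows "w \<in> level r p q m"
  using assms pair_op_pairs[of z r p q k w] min_excess_pair_op[of z m k w]
  unfolding level_def by auto

lemma closed_level: "closed_crystal {1..r} (pair_crystal (level r p q m))"
  using pair_op_level unfolding closed_crystal_def by simp

definition step :: "nat set \<times> nat set \<Rightarrow> nat set \<times> nat set" where
  "step z = transfer (THE x. crossing z x) z"

lemma step_eq: "crossing z x \<Longrightarrow> step z = transfer x z"
  unfolding step_def using crossing_unique by (metis the_equality)

lemma level_crossing:
  assumes "z \<in> level r p q m" "m < int q - int p"
  obtains x where "crossing z x" "excess z (x - 1) = m"
proof -
  have "min_excess z m" "\<And>v. r + 1 \<le> v \<Longrightarrow> m < excess z v"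
    using assms excess_total[of z r p q] by (auto simp: level_def)
  then show ?thesis using crossing_exists that by blast
qed

lemma step_level:
  assumes z: "z \<in> level r p q m" and "m < int q - int p"
  shows "step z \<in> level r (Suc p) (q - 1) (m - 1)"
proof -
  obtain x where x: "crossing z x" "excess z (x - 1) = m" using level_crossing assms by blast
  obtain A B where AB: "z = (A, B)" by (metis surj_pair)
  note mem = crossing_mem[OF x(1)[unfolded AB]]
  note e = excess_transfer[OF mem, folded AB]
  have fin: "finite A" "finite B" using z pairs_finite AB by (auto simp: level_def)
  have "transfer x z \<in> pairs r (Suc p) (q - 1)"
    using z mem fin by (auto simp: AB transfer_def level_def pairs_def)
  moreover have "m - 1 \<le> excess (transfer x z) v" for v
  proof -
    have "m \<le> excess z v" "x \<le> v \<Longrightarrow> m < excess z v" using x by (auto simp: crossing_def)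
    then show ?thesis by (cases "x \<le> v") (simp_all add: e)
  qed
  moreover have "excess (transfer x z) x = m - 1"
    using excess_Suc[of A B "x - 1"] mem x(2) by (simp add: e) (simp add: AB)
  ultimately show ?thesis
    using step_eq[OF x(1)] by (auto simp: level_def min_excess_def)
qed

lemma pairF_step:
  assumes "z \<in> level r p q m" "m < int q - int p" "1 \<le> k"
  shows "pairF k (step z) = map_option step (pairF k z)"
proof -
  obtain x where x: "crossing z x" using level_crossing assms(1,2) by blast
  show ?thesis
    using pairF_transfer_Some[OF x _ assms(3)] pair_op_transfer_None(1)[OF x assms(3)] step_eq[OF x] step_eq
    by (cases "pairF k z") fastforce+
qed

text \<open>If \<open>E\<^sub>k z\<close> is defined, commutation with \<open>E\<^sub>k\<close> follows from that with \<open>F\<^sub>k\<close> at \<open>E\<^sub>k z\<close>, which is in the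
  same level and so has a crossing point as well.\<close>

lemma pairE_step:
  assumes "z \<in> level r p q m" "m < int q - int p" "k \<in> {1..r}"
  shows "pairE k (step z) = map_option step (pairE k z)"
proof (cases "pairE k z")
  case None
  obtain x where x: "crossing z x" using level_crossing assms(1,2) by blast
  show ?thesis using pair_op_transfer_None(2)[OF x] None assms(3) step_eq[OF x] by simp
next
  case (Some w)
  then have "w \<in> level r p q m" "pairF k w = Some z"
    using pair_op_level assms(1,3) pairF_iff_pairE by blast+
  then have "pairF k (step w) = Some (step z)" using pairF_step assms by fastforce
  then show ?thesis using Some pairF_iff_pairE by simp
qed

text \<open>From \<open>x\<close> on, the transfer subtracts \<open>2\<close> from a walk that is above \<open>m\<close> there, with value \<open>m + 1\<close>
  at \<open>x\<close> itself. So \<open>x\<close> can be recovered as the first place where the new walk takes its minimum.\<close>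

lemma step_left_inverse:
  assumes "z \<in> level r p q m" "m < int q - int p"
  defines "y \<equiv> LEAST v. excess (step z) v = m - 1"
  shows "(fst (step z) - {y}, insert y (snd (step z))) = z"
proof -
  obtain x where x: "crossing z x" "excess z (x - 1) = m" using level_crossing assms by blast
  obtain A B where AB: "z = (A, B)" by (metis surj_pair)
  note mem = crossing_mem[OF x(1)[unfolded AB]]
  note e = excess_transfer[OF mem, folded AB]
  have "excess (transfer x z) x = m - 1"
    using excess_Suc[of A B "x - 1"] mem x(2) by (simp add: e) (simp add: AB)
  moreover have "x \<le> v" if "excess (transfer x z) v = m - 1" for v
  proof (rule ccontr)
    assume "\<not> x \<le> v"
    then have "excess z v = m - 1" using that by (simp add: e)
    moreover have "m \<le> excess z v" using x by (auto simp: crossing_def)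
    ultimately show False by simp
  qed
  ultimately have "y = x" unfolding y_def step_eq[OF x(1)] by (rule Least_equality)
  then show ?thesis using mem unfolding step_eq[OF x(1)] by (auto simp: AB transfer_def)
qed

text \<open>The assumption \<open>m \<le> 0\<close> ensures that the new minimum is negative, hence that it is not already
  attained at \<open>0\<close>, where the walk starts.\<close>

lemma step_surj:
  assumes w: "w \<in> level r (Suc p) (q - 1) (m - 1)" and "m \<le> 0" "1 \<le> q"
  shows "\<exists>z \<in> level r p q m. step z = w"
proof -
  obtain C D where CD: "w = (C, D)" by (metis surj_pair)
  define x where "x = (LEAST v. excess w v = m - 1)"
  have low: "m - 1 \<le> excess w v" for v using w by (simp add: level_def min_excess_def)
  have "\<exists>v. excess w v = m - 1" using w by (simp add: level_def min_excess_def)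
  then have ex: "excess w x = m - 1" unfolding x_def by (rule LeastI_ex)
  have below: "m \<le> excess w v" if "v < x" for v
    using not_less_Least[of v "\<lambda>v. excess w v = m - 1"] that low[of v] unfolding x_def by force
  have x1: "1 \<le> x" using ex assms(2) by (cases x) auto
  then have prev: "m \<le> excess w (x - 1)" using below by simp
  have "excess w x = excess w (x - 1) + of_bool (x \<in> D) - of_bool (x \<in> C)"
    using excess_Suc[of C D "x - 1"] x1 by (simp add: CD)
  then have mem: "x \<in> C" "x \<notin> D" and prev_eq: "excess w (x - 1) = m"
    using ex prev by (cases "x \<in> C"; cases "x \<in> D"; simp)+
  let ?z = "(C - {x}, insert x D)"
  have tr: "transfer x ?z = w" using mem by (auto simp: CD transfer_def)
  have e: "excess ?z v = excess w v + 2 * of_bool (x \<le> v)" for v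
    using excess_transfer[of x "insert x D" "C - {x}" v] x1 tr by simp
  have base: "excess ?z (x - 1) = m" using e prev_eq x1 by simp
  have high: "m < excess ?z v" if "x \<le> v" for v using low[of v] that by (simp add: e)
  have all: "m \<le> excess ?z v" for v
    using below[of v] high[of v] by (cases "x \<le> v") (auto simp: e)
  have "crossing ?z x" unfolding crossing_def base using x1 high all by simp
  then have "step ?z = w" using step_eq tr by simp
  moreover have fin: "finite C" "finite D" using w pairs_finite CD by (auto simp: level_def)
  have "?z \<in> pairs r p q"
    using w mem fin assms(3) by (auto simp: level_def pairs_def CD)
  then have "?z \<in> level r p q m" using all base by (auto simp: level_def min_excess_def)
  ultimately show ?thesis by blast
qed

lemma content_step:
  assumes "z \<in> level r p q m" "m < int q - int p"
  shows "content (step z) = content z"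
proof -
  obtain x where x: "crossing z x" using level_crossing assms by blast
  obtain A B where AB: "z = (A, B)" by (metis surj_pair)
  show ?thesis
    using crossing_mem[OF x[unfolded AB]] unfolding step_eq[OF x]
    by (auto simp: AB transfer_def content_def)
qed

lemma step_strict_bij:
  assumes "m < int q - int p" "m \<le> 0" "1 \<le> q"
  shows "strict_bij {1..r} (pair_crystal (level r p q m)) (pair_crystal (level r (Suc p) (q - 1) (m - 1))) step"
proof -
  have "inj_on step (level r p q m)"
    by (rule inj_on_inverseI, rule step_left_inverse[OF _ assms(1)])
  moreover have "step ` level r p q m = level r (Suc p) (q - 1) (m - 1)"
    using step_level[OF _ assms(1)] step_surj[OF _ assms(2,3)] by blast
  ultimately show ?thesis
    using closed_level pairF_step[OF _ assms(1)] pairE_step[OF _ assms(1)] content_step[OF _ assms(1)]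
    by (simp add: strict_bij_def bij_betw_def commutes_with_ops_def)
qed

lemma steps_strict_bij:
  assumes "n \<le> q - p"
  shows "strict_bij {1..r} (pair_crystal (level r p q 0)) (pair_crystal (level r (p + n) (q - n) (- int n)))
    (step ^^ n)"
  using assms
proof (induction n)
  case 0
  then show ?case using strict_bij_id[OF closed_level] by (simp add: id_def)
next
  case (Suc n)
  have "strict_bij {1..r} (pair_crystal (level r (p + n) (q - n) (- int n)))
      (pair_crystal (level r (Suc (p + n)) (q - n - 1) (- int n - 1))) step"
    by (rule step_strict_bij) (use Suc.prems in auto)
  from strict_bij_comp[OF Suc.IH this] Suc.prems
  have "strict_bij {1..r} (pair_crystal (level r p q 0))
      (pair_crystal (level r (Suc (p + n)) (q - n - 1) (- int n - 1))) (step ^^ Suc n)" by simp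
  moreover have "p + Suc n = Suc (p + n)" "q - Suc n = q - n - 1" "- int (Suc n) = - int n - 1"
    by auto
  ultimately show ?case by (simp only:)
qed

section \<open>The Cartan component\<close>

text \<open>The walk is as high as its two end points permit. For \<open>p \<le> q\<close> this says that the top-aligned
  columns form a semistandard tableau, for \<open>p \<ge> q\<close> that the bottom-aligned columns do.\<close>

definition cartan_pairs :: "nat \<Rightarrow> nat \<Rightarrow> nat \<Rightarrow> (nat set \<times> nat set) set" where
  "cartan_pairs r p q = level r p q (min 0 (int q - int p))"

definition hw_pair :: "nat \<Rightarrow> nat \<Rightarrow> nat set \<times> nat set" where
  "hw_pair p q = ({1..p}, {1..q})"

lemma hw_pair_cartan:
  assumes "p \<le> r + 1" "q \<le> r + 1"
  shows "hw_pair p q \<in> cartan_pairs r p q"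
proof -
  have e: "excess (hw_pair p q) v = int (min q v) - int (min p v)" for v
    by (simp add: excess_def hw_pair_def Int_atLeastAtMost)
  have "min 0 (int q - int p) \<le> excess (hw_pair p q) v" for v by (auto simp: e)
  moreover have "excess (hw_pair p q) (if p \<le> q then 0 else p) = min 0 (int q - int p)"
    by (auto simp: e)
  ultimately have "min_excess (hw_pair p q) (min 0 (int q - int p))" unfolding min_excess_def by blast
  then show ?thesis using assms by (auto simp: cartan_pairs_def level_def pairs_def hw_pair_def)
qed

lemma downward_closed_set:
  assumes "A \<subseteq> {1..N}" "\<And>k. 1 \<le> k \<Longrightarrow> Suc k \<in> A \<Longrightarrow> k \<in> A"
  shows "A = {1..card A}"
proof (cases "A = {}")
  case False
  have fin: "finite A" using assms(1) finite_subset by blast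
  have "k \<in> A" if "1 \<le> k" "k \<le> Max A" for k
    using that(2,1)
  proof (induction rule: inc_induct)
    case base
    then show ?case using Max_in[OF fin False] by simp
  next
    case (step n)
    then show ?case using assms(2)[of n] by simp
  qed
  then have "A = {1..Max A}" using assms(1) Max_ge[OF fin] by auto
  then show ?thesis by (metis card_atLeastAtMost diff_Suc_1)
qed simp

text \<open>If no \<open>E\<^sub>k\<close> applies, then \<open>A\<close> is an initial segment, and \<open>B\<close> can only have a gap at \<open>p\<close>, the end
  of that segment. Such a gap would make the walk at \<open>p\<close> smaller than at both ends.\<close>

lemma cartan_pairs_highest:
  assumes z: "z \<in> cartan_pairs r p q" and kill: "\<And>k. k \<in> {1..r} \<Longrightarrow> pairE k z = None"
  shows "z = hw_pair p q"
proof -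
  obtain A B where AB: "z = (A, B)" by (metis surj_pair)
  have pr: "z \<in> pairs r p q" and low: "\<And>v. min 0 (int q - int p) \<le> excess z v"
    using z by (auto simp: cartan_pairs_def level_def min_excess_def)
  have sub: "A \<subseteq> {1..r + 1}" "B \<subseteq> {1..r + 1}" and card: "card A = p" "card B = q"
    using pr by (auto simp: AB pairs_def)
  have fin: "finite B" using sub(2) finite_subset by blast
  have k: "k \<in> {1..r}" if "1 \<le> k" "Suc k \<in> A \<or> Suc k \<in> B" for k using that sub by auto
  note kill' = kill[unfolded AB pair_op_None_iff]
  have "A = {1..card A}"
    by (rule downward_closed_set[OF sub(1)]) (use kill' k in blast)
  then have A: "A = {1..p}" unfolding card .
  have down: "k \<in> B" if k1: "1 \<le> k" and kB: "Suc k \<in> B" for k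
  proof (rule ccontr)
    assume "k \<notin> B"
    then have "k \<in> A" "Suc k \<notin> A" using kill'[of k] k[OF k1] kB by auto
    then have kp: "k = p" using A by auto
    have "p \<notin> B" "1 \<le> p" "Suc p \<in> B" using \<open>k \<notin> B\<close> k1 kB kp by simp_all
    then have "p \<in> {1..p}" "p \<notin> B \<inter> {1..p}" by simp_all
    then have "B \<inter> {1..p} \<subset> {1..p}" by blast
    then have "card (B \<inter> {1..p}) < p" using psubset_card_mono[of "{1..p}"] by simp
    moreover have "Suc p \<notin> B \<inter> {1..p}" by simp
    then have "B \<inter> {1..p} \<subset> B" using \<open>Suc p \<in> B\<close> by blast
    then have "card (B \<inter> {1..p}) < q" using psubset_card_mono[OF fin] card by simp
    moreover have "excess z p = int (card (B \<inter> {1..p})) - int p" by (simp add: AB excess_def A)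
    ultimately show False using low[of p] by simp
  qed
  have "B = {1..card B}" by (rule downward_closed_set[OF sub(2) down])
  then have "B = {1..q}" unfolding card .
  then show ?thesis using A AB by (simp add: hw_pair_def)
qed

lemma sum_lower_element:
  assumes "finite A" "Suc k \<in> A" "k \<notin> A"
  shows "\<Sum>(insert k (A - {Suc k})) < \<Sum>A"
proof -
  have "\<Sum>A = Suc k + \<Sum>(A - {Suc k})" using assms(1,2) by (rule sum.remove)
  then show ?thesis using assms(1,3) by simp
qed

lemma cartan_pairs_generated:
  assumes "p \<le> r" "q \<le> r"
  shows "generated_by {1..r} (pair_crystal (cartan_pairs r p q)) (hw_pair p q)"
proof -
  let ?G = "crystal_graph {1..r} (pair_crystal (cartan_pairs r p q))"
  have "(hw_pair p q, z) \<in> ?G\<^sup>*" if "z \<in> cartan_pairs r p q" for z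
    using that
  proof (induction "\<Sum>(fst z) + \<Sum>(snd z)" arbitrary: z rule: less_induct)
    case less
    show ?case
    proof (cases "z = hw_pair p q")
      case False
      then obtain k where "k \<in> {1..r}" "pairE k z \<noteq> None"
        using cartan_pairs_highest[OF less.prems] by blast
      then obtain w where k: "k \<in> {1..r}" "pairE k z = Some w" by blast
      have w: "w \<in> cartan_pairs r p q"
        using pair_op_level less.prems k unfolding cartan_pairs_def by blast
      obtain A B where AB: "z = (A, B)" by (metis surj_pair)
      have "finite A" "finite B"
        using less.prems pairs_finite AB by (auto simp: cartan_pairs_def level_def)
      note lower = sum_lower_element[OF this(1), of k] sum_lower_element[OF this(2), of k]
      consider "Suc k \<in> B" "k \<notin> B" "w = (A, insert k (B - {Suc k}))" |
        "Suc k \<in> A" "k \<notin> A" "w = (insert k (A - {Suc k}), B)"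
        using k(2) by (auto simp: AB pairE_def split: if_splits)
      then have "\<Sum>(fst w) + \<Sum>(snd w) < \<Sum>(fst z) + \<Sum>(snd z)"
      proof cases
        case 1
        show ?thesis using lower(2)[OF 1(1,2)] by (simp only: 1(3) AB fst_conv snd_conv add_less_cancel_left)
      next
        case 2
        show ?thesis using lower(1)[OF 2(1,2)] by (simp only: 2(3) AB fst_conv snd_conv add_less_cancel_right)
      qed
      then have "(hw_pair p q, w) \<in> ?G\<^sup>*" using less.hyps w by blast
      moreover have "(w, z) \<in> ?G"
        unfolding crystal_graph_def pair_crystal_simps using k w less.prems
        by (auto simp: pairF_iff_pairE)
      ultimately show ?thesis by simp
    qed simp
  qed
  then show ?thesis using hw_pair_cartan assms by (simp add: generated_by_def)
qed

text \<open>The weight determines the multiset of entries: the multiplicities agree up to an additive constant,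
  which is zero because \<open>1\<close> occurs twice and \<open>r + 1\<close> does not occur in the highest weight pair.
  The entries up to \<open>min p q\<close> then lie in both columns, so they fill the shorter one.\<close>

lemma hw_weight_unique:
  assumes z: "z \<in> pairs r p q" and pq: "p \<in> {1..r}" "q \<in> {1..r}"
    and wt: "\<And>k. k \<in> {1..r} \<Longrightarrow>
      content z k - content z (Suc k) = content (hw_pair p q) k - content (hw_pair p q) (Suc k)"
  shows "z = hw_pair p q"
proof -
  obtain A B where AB: "z = (A, B)" by (metis surj_pair)
  have sub: "A \<subseteq> {1..r + 1}" "B \<subseteq> {1..r + 1}" and card: "card A = p" "card B = q"
    using z by (auto simp: AB pairs_def)
  define c where "c = content z 1 - content (hw_pair p q) 1"
  have const: "content z k = content (hw_pair p q) k + c" if "1 \<le> k" "k \<le> r + 1" for k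
    using that
  proof (induction k rule: dec_induct)
    case (step n)
    then show ?case using wt[of n] by simp
  qed (simp add: c_def)
  have "content (hw_pair p q) 1 = 2" "content (hw_pair p q) (r + 1) = 0"
    using pq by (auto simp: content_def hw_pair_def)
  moreover have "content z 1 \<le> 2" "0 \<le> content z (r + 1)" by (simp_all add: content_def AB)
  ultimately have "c = 0" using const[of 1] const[of "r + 1"] pq by simp
  then have m: "of_bool (k \<in> A) + of_bool (k \<in> B) = (of_bool (k \<le> p) + of_bool (k \<le> q) :: int)"
    if "k \<in> {1..r + 1}" for k
    using const[of k] that by (simp add: content_def hw_pair_def AB)
  have fin: "finite A" "finite B" using sub finite_subset by blast+
  have both: "k \<in> A \<and> k \<in> B" if "1 \<le> k" "k \<le> p" "k \<le> q" for k
    using m[of k] that pq by (cases "k \<in> A"; cases "k \<in> B") auto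
  have "A = {1..p} \<and> B = {1..q}"
  proof (cases "p \<le> q")
    case True
    then have "{1..p} \<subseteq> A" using both by auto
    then have A: "A = {1..p}" by (intro card_subset_eq[OF fin(1), symmetric]) (simp_all add: card)
    have "{1..q} \<subseteq> B"
    proof
      fix k assume "k \<in> {1..q}"
      then show "k \<in> B" using m[of k] pq by (cases "k \<in> B"; cases "k \<le> p") (auto simp: A)
    qed
    then have "B = {1..q}" by (intro card_subset_eq[OF fin(2), symmetric]) (simp_all add: card)
    then show ?thesis using A by simp
  next
    case False
    then have "{1..q} \<subseteq> B" using both by auto
    then have B: "B = {1..q}" by (intro card_subset_eq[OF fin(2), symmetric]) (simp_all add: card)
    have "{1..p} \<subseteq> A"
    proof
      fix k assume "k \<in> {1..p}"
      then show "k \<in> A" using m[of k] pq by (cases "k \<in> A"; cases "k \<le> q") (auto simp: B)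
    qed
    then have "A = {1..p}" by (intro card_subset_eq[OF fin(1), symmetric]) (simp_all add: card)
    then show ?thesis using B by simp
  qed
  then show ?thesis by (simp add: AB hw_pair_def)
qed

section \<open>Columns and tableaux\<close>

text \<open>A column is determined by its set of entries. The entries are compared below through the walk,
  which is insensitive to the rows they are in; \<open>less_card_iff_nth_col\<close> translates back to rows.\<close>

definition col :: "nat set \<Rightarrow> nat list" where
  "col A = sorted_list_of_set A"

lemma col_simps [simp]:
  "sorted_wrt (<) (col A)" "length (col A) = card A" "finite A \<Longrightarrow> set (col A) = A"
  by (simp_all add: col_def)

lemma col_unique: "sorted_wrt (<) xs \<Longrightarrow> set xs = A \<Longrightarrow> xs = col A"
  using strict_sorted_equal[of xs "col A"] by auto

text \<open>No operator applies twice to the same column, so \<open>\<epsilon>\<^sub>i\<close> and \<open>\<phi>\<^sub>i\<close> of a column are \<open>0\<close> or \<open>1\<close>.\<close>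

lemma greatest_iter_square_zero:
  assumes "\<And>y. h x = Some y \<Longrightarrow> h y = None"
  shows "(GREATEST k. iter_op h k x \<noteq> None) = of_bool (h x \<noteq> None)"
proof (rule Greatest_equality)
  show "iter_op h (of_bool (h x \<noteq> None)) x \<noteq> None" by (cases "h x") auto
next
  fix k assume k: "iter_op h k x \<noteq> None"
  have "iter_op h (Suc (Suc n)) x = None" for n
  proof (induction n)
    case 0
    then show ?case using assms by (cases "h x") auto
  next
    case (Suc n)
    then show ?case by (subst iter_op_simps(2)) simp
  qed
  then have "k = 0 \<or> k = 1" using k by (metis One_nat_def old.nat.exhaust)
  then show "k \<le> of_bool (h x \<noteq> None)" using k by (cases "h x") auto
qed

lemma map_col:
  assumes "finite A" "strict_mono_on A f"
  shows "map f (col A) = col (f ` A)"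
proof (rule col_unique)
  show "sorted_wrt (<) (map f (col A))"
    unfolding sorted_wrt_map
    by (rule sorted_wrt_mono_rel[OF _ col_simps(1)])
      (use assms in \<open>auto simp: strict_mono_on_def\<close>)
qed (use assms in auto)

lemma column_ops:
  assumes "finite A"
  shows "Eop (column_crystal r) k (col A) =
      (if Suc k \<in> A \<and> k \<notin> A then Some (col (insert k (A - {Suc k}))) else None)"
    and "Fop (column_crystal r) k (col A) =
      (if k \<in> A \<and> Suc k \<notin> A then Some (col (insert (Suc k) (A - {k}))) else None)"
    and "wt (column_crystal r) (col A) k = of_bool (k \<in> A) - of_bool (Suc k \<in> A)"
proof -
  have E: "map (\<lambda>x. if x = k + 1 then k else x) (col A) = col (insert k (A - {Suc k}))"
    if "Suc k \<in> A" "k \<notin> A"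
  proof -
    have "strict_mono_on A (\<lambda>x. if x = k + 1 then k else x)"
      using that(2) by (auto simp: strict_mono_on_def) (metis less_SucE)
    moreover have "(\<lambda>x. if x = k + 1 then k else x) ` A = insert k (A - {Suc k})"
      using that(1) by (auto simp: image_iff)
    ultimately show ?thesis using map_col[OF assms] by simp
  qed
  have F: "map (\<lambda>x. if x = k then k + 1 else x) (col A) = col (insert (Suc k) (A - {k}))"
    if "k \<in> A" "Suc k \<notin> A"
  proof -
    have "strict_mono_on A (\<lambda>x. if x = k then k + 1 else x)"
      using that(2) by (auto simp: strict_mono_on_def) (metis Suc_lessI)
    moreover have "(\<lambda>x. if x = k then k + 1 else x) ` A = insert (Suc k) (A - {k})"
      using that(1) by (auto simp: image_iff)
    ultimately show ?thesis using map_col[OF assms] by simp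
  qed
  show "Eop (column_crystal r) k (col A) =
      (if Suc k \<in> A \<and> k \<notin> A then Some (col (insert k (A - {Suc k}))) else None)"
    and "Fop (column_crystal r) k (col A) =
      (if k \<in> A \<and> Suc k \<notin> A then Some (col (insert (Suc k) (A - {k}))) else None)"
    and "wt (column_crystal r) (col A) k = of_bool (k \<in> A) - of_bool (Suc k \<in> A)"
    using E F assms by (simp_all add: column_crystal_def)
qed

lemma columns_eq: "columns r = col ` {A. A \<subseteq> {1..r + 1}}"
proof (intro equalityI subsetI)
  fix c assume c: "c \<in> columns r"
  then have "c = col (set c)" by (intro col_unique) (auto simp: columns_def)
  moreover have "set c \<subseteq> {1..r + 1}" using c by (simp add: columns_def)
  ultimately show "c \<in> col ` {A. A \<subseteq> {1..r + 1}}" by blast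
next
  fix c assume "c \<in> col ` {A. A \<subseteq> {1..r + 1}}"
  then obtain A where A: "A \<subseteq> {1..r + 1}" "c = col A" by blast
  then have "finite A" using finite_subset by blast
  then show "c \<in> columns r" using A by (simp add: columns_def)
qed

lemma elems_fund_col:
  assumes "p \<in> {1..r}"
  shows "elems (hw_crystal r (fund_wt p)) = (\<lambda>A. [col A]) ` {A. A \<subseteq> {1..r + 1} \<and> card A = p}"
proof -
  have "{c \<in> columns r. length c = p} = col ` {A. A \<subseteq> {1..r + 1} \<and> card A = p}"
    unfolding columns_eq by auto
  then show ?thesis unfolding elems_hw_crystal_fund[OF assms] by (simp only: image_image)
qed

lemma hw_crystal_fund_simps:
  assumes "p \<in> {1..r}" "finite A"
  shows "Eop (hw_crystal r (fund_wt p)) k [col A] =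
      (if Suc k \<in> A \<and> k \<notin> A then Some [col (insert k (A - {Suc k}))] else None)"
    and "Fop (hw_crystal r (fund_wt p)) k [col A] =
      (if k \<in> A \<and> Suc k \<notin> A then Some [col (insert (Suc k) (A - {k}))] else None)"
    and "wt (hw_crystal r (fund_wt p)) [col A] k = of_bool (k \<in> A) - of_bool (Suc k \<in> A)"
    and "eps (hw_crystal r (fund_wt p)) k [col A] = of_bool (Suc k \<in> A \<and> k \<notin> A)"
    and "phi (hw_crystal r (fund_wt p)) k [col A] = of_bool (k \<in> A \<and> Suc k \<notin> A)"
proof -
  have E: "Eop (hw_crystal r (fund_wt p)) k [col C] =
      (if Suc k \<in> C \<and> k \<notin> C then Some [col (insert k (C - {Suc k}))] else None)"
    if "finite C" for C
    using column_ops(1)[OF that] ops_hw_crystal_fund(2)[OF assms(1)] by simp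
  have F: "Fop (hw_crystal r (fund_wt p)) k [col C] =
      (if k \<in> C \<and> Suc k \<notin> C then Some [col (insert (Suc k) (C - {k}))] else None)"
    if "finite C" for C
    using column_ops(2)[OF that] ops_hw_crystal_fund(1)[OF assms(1)] by simp
  show "Eop (hw_crystal r (fund_wt p)) k [col A] =
      (if Suc k \<in> A \<and> k \<notin> A then Some [col (insert k (A - {Suc k}))] else None)"
    and "Fop (hw_crystal r (fund_wt p)) k [col A] =
      (if k \<in> A \<and> Suc k \<notin> A then Some [col (insert (Suc k) (A - {k}))] else None)"
    by (fact E[OF assms(2)] F[OF assms(2)])+
  have one: "(\<Sum>m = 1..r. fund_wt p m) = 1" using assms by (simp add: fund_wt_def)
  show "wt (hw_crystal r (fund_wt p)) [col A] k = of_bool (k \<in> A) - of_bool (Suc k \<in> A)"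
    using one column_ops(3)[OF assms(2)]
    by (simp add: hw_crystal_def subcrystal_def cons_crystal_def tensor_def)
  show "eps (hw_crystal r (fund_wt p)) k [col A] = of_bool (Suc k \<in> A \<and> k \<notin> A)"
    by (subst eps_def, subst greatest_iter_square_zero) (use assms(2) in \<open>auto simp: E split: if_splits\<close>)
  show "phi (hw_crystal r (fund_wt p)) k [col A] = of_bool (k \<in> A \<and> Suc k \<notin> A)"
    by (subst phi_def, subst greatest_iter_square_zero) (use assms(2) in \<open>auto simp: F split: if_splits\<close>)
qed

definition encode :: "nat set \<times> nat set \<Rightarrow> nat list list \<times> nat list list" where
  "encode = (\<lambda>(A, B). ([col A], [col B]))"

definition tableau_of :: "nat set \<times> nat set \<Rightarrow> nat list list" where
  "tableau_of = (\<lambda>(A, B). [col A, col B])"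

lemma col_inj: "finite A \<Longrightarrow> finite B \<Longrightarrow> col A = col B \<Longrightarrow> A = B"
  by (metis col_simps(3))

lemma pairs_col_inj:
  assumes "(A, B) \<in> pairs r p q" "(C, D) \<in> pairs r p q" "col A = col C" "col B = col D"
  shows "(A, B) = (C, D)"
  using pairs_finite[OF assms(1)] pairs_finite[OF assms(2)] col_inj assms(3,4) by simp

lemma encode_strict_bij:
  assumes "p \<in> {1..r}" "q \<in> {1..r}"
  shows "strict_bij {1..r} (pair_crystal (pairs r p q))
    (tensor (hw_crystal r (fund_wt p)) (hw_crystal r (fund_wt q))) encode"
proof -
  let ?T = "tensor (hw_crystal r (fund_wt p)) (hw_crystal r (fund_wt q))"
  have pairs_prod: "pairs r p q = {A. A \<subseteq> {1..r + 1} \<and> card A = p} \<times> {B. B \<subseteq> {1..r + 1} \<and> card B = q}"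
    by (auto simp: pairs_def)
  have "encode ` pairs r p q = elems ?T"
    unfolding tensor_def crystal.simps elems_fund_col[OF assms(1)] elems_fund_col[OF assms(2)]
    unfolding pairs_prod encode_def by (rule image_paired_Times)
  moreover have "inj_on encode (pairs r p q)"
    unfolding encode_def by (rule inj_onI) (use pairs_col_inj in \<open>simp split: prod.splits\<close>)
  moreover have "commutes_with_ops {1..r} (pair_crystal (pairs r p q)) ?T encode"
    unfolding commutes_with_ops_def
  proof (intro ballI)
    fix z k assume "z \<in> elems (pair_crystal (pairs r p q))"
    then obtain A B where z: "z = (A, B)" "(A, B) \<in> pairs r p q" by (cases z) simp
    have fin: "finite A" "finite B" using z(2) pairs_finite by blast+
    show "wt ?T (encode z) k = wt (pair_crystal (pairs r p q)) z k \<and>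
        Eop ?T k (encode z) = map_option encode (Eop (pair_crystal (pairs r p q)) k z) \<and>
        Fop ?T k (encode z) = map_option encode (Fop (pair_crystal (pairs r p q)) k z)"
      by (auto simp: z(1) encode_def tensor_def pairE_def pairF_def content_def
          hw_crystal_fund_simps[OF assms(1) fin(1)] hw_crystal_fund_simps[OF assms(2) fin(2)])
  qed
  ultimately show ?thesis using closed_pairs by (simp add: strict_bij_def bij_betw_def)
qed

lemma strict_bij_sub:
  assumes "strict_bij I (pair_crystal Y) B h" "X \<subseteq> Y" "closed_crystal I (pair_crystal X)"
  shows "strict_bij I (pair_crystal X) (subcrystal B (h ` X)) h"
  using assms by (auto simp: strict_bij_def commutes_with_ops_def bij_betw_def inj_on_subset)

lemma less_card_iff_nth_col:
  assumes "finite A" "0 \<notin> A"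
  shows "k < card (A \<inter> {1..v}) \<longleftrightarrow> k < card A \<and> col A ! k \<le> v"
proof -
  let ?c = "col A"
  have sorted: "?c ! i < ?c ! j" if "i < j" "j < card A" for i j
    using sorted_wrt_nth_less[OF col_simps(1)] that by simp
  have distinct: "distinct ?c" using col_simps(1) strict_sorted_iff by blast
  have pos: "1 \<le> a" if "a \<in> A" for a using that assms(2) by (cases a) auto
  show ?thesis
  proof
    assume l: "k < card (A \<inter> {1..v})"
    then have k: "k < card A" using card_mono[OF assms(1), of "A \<inter> {1..v}"] by auto
    moreover have "?c ! k \<le> v"
    proof (rule ccontr)
      assume v: "\<not> ?c ! k \<le> v"
      have "A \<inter> {1..v} \<subseteq> set (take k ?c)"
      proof
        fix a assume a: "a \<in> A \<inter> {1..v}"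
        then obtain i where i: "i < card A" "?c ! i = a"
          using assms(1) by (metis IntD1 col_simps(2,3) in_set_conv_nth)
        then have "i < k" using a v sorted[of k i] by (cases "i < k"; cases "i = k") auto
        then show "a \<in> set (take k ?c)" using i by (auto simp: in_set_conv_nth)
      qed
      then have "card (A \<inter> {1..v}) \<le> card (set (take k ?c))" by (simp add: card_mono)
      also have "\<dots> \<le> k" using card_length[of "take k ?c"] by simp
      finally show False using l by simp
    qed
    ultimately show "k < card A \<and> ?c ! k \<le> v" by simp
  next
    assume k: "k < card A \<and> ?c ! k \<le> v"
    have "set (take (Suc k) ?c) \<subseteq> A \<inter> {1..v}"
    proof
      fix a assume "a \<in> set (take (Suc k) ?c)"
      then obtain i where i: "i \<le> k" "?c ! i = a" by (auto simp: in_set_conv_nth less_Suc_eq_le)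
      then have "a \<in> A" using k assms(1) by (metis col_simps(2,3) le_less_trans nth_mem)
      moreover have "a \<le> v" using i k sorted[of i k] by (cases "i = k") auto
      ultimately show "a \<in> A \<inter> {1..v}" using pos by auto
    qed
    then have "card (set (take (Suc k) ?c)) \<le> card (A \<inter> {1..v})"
      using assms(1) by (intro card_mono) auto
    moreover have "card (set (take (Suc k) ?c)) = Suc k"
      using distinct_card[OF distinct_take[OF distinct, of "Suc k"]] k by simp
    ultimately show "k < card (A \<inter> {1..v})" by simp
  qed
qed

text \<open>The \<open>n\<close>-th entry from above of a column is at most \<open>v\<close> iff the column has at least \<open>n\<close> entries up
  to \<open>v\<close>. So comparing the rows amounts to comparing these numbers of entries for all \<open>v\<close>.\<close>

lemma excess_bound_iff_dominates:
  assumes z: "(A, B) \<in> pairs r p q" and pq: "p \<le> q + t"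
  shows "(\<forall>v. - int t \<le> excess (A, B) v) \<longleftrightarrow> (\<forall>k. t + k < p \<longrightarrow> col B ! k \<le> col A ! (t + k))"
proof -
  have fin: "finite A" "finite B" using z pairs_finite by blast+
  have no0: "0 \<notin> A" "0 \<notin> B" and card: "card A = p" "card B = q" using z by (auto simp: pairs_def)
  note less_A = less_card_iff_nth_col[OF fin(1) no0(1)] and less_B = less_card_iff_nth_col[OF fin(2) no0(2)]
  show ?thesis
  proof (intro iffI allI impI)
    fix k assume low: "\<forall>v. - int t \<le> excess (A, B) v" and k: "t + k < p"
    let ?v = "col A ! (t + k)"
    have "t + k < card (A \<inter> {1..?v})" using less_A k card by simp
    moreover have "- int t \<le> int (card (B \<inter> {1..?v})) - int (card (A \<inter> {1..?v}))"
      using spec[OF low, of ?v] by (simp only: excess_def case_prod_conv)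
    ultimately have "k < card (B \<inter> {1..?v})" by linarith
    then show "col B ! k \<le> ?v" using less_B by blast
  next
    fix v assume dom: "\<forall>k. t + k < p \<longrightarrow> col B ! k \<le> col A ! (t + k)"
    show "- int t \<le> excess (A, B) v"
    proof (rule ccontr)
      let ?k = "card (B \<inter> {1..v})"
      assume "\<not> - int t \<le> excess (A, B) v"
      then have "t + ?k < card (A \<inter> {1..v})" by (simp add: excess_def)
      then have "t + ?k < p" "col A ! (t + ?k) \<le> v" using less_A card by auto
      then have "?k < card B" "col B ! ?k \<le> v" using dom pq card by (auto intro: order_trans)
      then show False using less_B[of ?k v] by simp
    qed
  qed
qed

lemma cartan_pairs_iff:
  assumes "p \<le> q"
  shows "(A, B) \<in> cartan_pairs r p q \<longleftrightarrow>
    (A, B) \<in> pairs r p q \<and> (\<forall>k < p. col B ! k \<le> col A ! k)"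
proof -
  have "min_excess z 0 \<longleftrightarrow> (\<forall>v. 0 \<le> excess z v)" for z
    by (auto simp: min_excess_def intro: exI[of _ 0])
  then show ?thesis
    using assms excess_bound_iff_dominates[of A B r p q 0] by (auto simp: cartan_pairs_def level_def)
qed

lemma tableau_of_image:
  assumes pq: "p \<in> {1..r}" "q \<in> {1..r}" "p \<le> q"
  shows "tableau_of ` cartan_pairs r p q = tableaux r (\<lambda>k. fund_wt p k + fund_wt q k)"
    (is "?L = tableaux r ?\<nu>")
proof (intro equalityI subsetI)
  fix T assume "T \<in> ?L"
  then obtain A B where T: "T = [col A, col B]" and AB: "(A, B) \<in> pairs r p q"
    and dom: "\<forall>k < p. col B ! k \<le> col A ! k"
    using cartan_pairs_iff[OF pq(3)] by (auto simp: tableau_of_def)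
  have card: "card A = p" "card B = q" and "set T \<subseteq> columns r"
    using AB by (auto simp: T pairs_def columns_eq)
  then show "T \<in> tableaux r ?\<nu>"
    using pq dom by (auto simp: tableaux_def T fund_wt_def less_Suc_eq)
next
  fix T assume T: "T \<in> tableaux r ?\<nu>"
  then have cols: "set T \<subseteq> columns r" and lens: "set (map length T) \<subseteq> {1..r}"
    and count: "\<And>k. k \<in> {1..r} \<Longrightarrow> count_list (map length T) k = ?\<nu> k"
    and sorted: "sorted (map length T)"
    and dom: "\<And>m a. Suc m < length T \<Longrightarrow> a < length (T ! m) \<Longrightarrow> T ! Suc m ! a \<le> T ! m ! a"
    by (auto simp: tableaux_def)
  have "length (map length T) = sum (count_list (map length T)) {1..r}"
    using sum_count_set[OF lens] by simp
  also have "\<dots> = sum ?\<nu> {1..r}" by (rule sum.cong) (use count in auto)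
  also have "\<dots> = 2" using pq by (simp add: fund_wt_def sum.distrib)
  finally obtain a b where ab: "T = [a, b]" by (auto simp: length_Suc_conv numeral_2_eq_2)
  have "length a = p \<and> length b = q"
    using count[OF pq(1)] count[OF pq(2)] sorted pq(3)
    by (auto simp: ab fund_wt_def split: if_splits)
  moreover obtain A B where AB: "A \<subseteq> {1..r + 1}" "B \<subseteq> {1..r + 1}" "a = col A" "b = col B"
    using cols by (auto simp: ab columns_eq)
  ultimately have "(A, B) \<in> cartan_pairs r p q"
    using dom[of 0] cartan_pairs_iff[OF pq(3)] by (auto simp: ab pairs_def)
  then show "T \<in> ?L" using AB by (force simp: ab tableau_of_def)
qed

lemma cons_tensor_simps:
  "wt (cons_crystal (tensor A B)) (b # l) k = wt A b k + wt B l k"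
  "Eop (cons_crystal (tensor A B)) k (b # l) =
     (if phi A k b \<ge> eps B k l then map_option (\<lambda>x. x # l) (Eop A k b)
      else map_option ((#) b) (Eop B k l))"
  "Fop (cons_crystal (tensor A B)) k (b # l) =
     (if phi A k b > eps B k l then map_option (\<lambda>x. x # l) (Fop A k b)
      else map_option ((#) b) (Fop B k l))"
  by (simp_all add: cons_crystal_def tensor_def option.map_comp o_def)

text \<open>The tableau crystal carries the operators of the tensor product of its columns from right to left,
  so for columns in this order the identification is the identity.\<close>

lemma tableau_of_strict_bij:
  assumes pq: "p \<in> {1..r}" "q \<in> {1..r}" "p \<le> q"
  shows "strict_bij {1..r} (pair_crystal (cartan_pairs r p q))
    (hw_crystal r (\<lambda>k. fund_wt p k + fund_wt q k)) tableau_of"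
proof -
  let ?H = "hw_crystal r (\<lambda>k. fund_wt p k + fund_wt q k)" and ?A = "column_crystal r"
  have one: "(\<Sum>m = 1..r. fund_wt q m) = 1" using pq by (simp add: fund_wt_def)
  have two: "(\<Sum>m = 1..r. fund_wt p m + fund_wt q m) = Suc (Suc 0)"
    using pq by (simp add: fund_wt_def sum.distrib)
  have right: "hw_crystal r (fund_wt q) = subcrystal (tensor_power ?A (Suc 0)) (tableaux r (fund_wt q))"
    using one by (simp add: hw_crystal_def)
  have "tableau_of ` cartan_pairs r p q = elems ?H"
    using tableau_of_image[OF pq] by (simp add: hw_crystal_def)
  moreover have "inj_on tableau_of (cartan_pairs r p q)"
    unfolding tableau_of_def cartan_pairs_def level_def
    by (rule inj_onI) (use pairs_col_inj in \<open>simp split: prod.splits\<close>)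
  moreover have "commutes_with_ops {1..r} (pair_crystal (cartan_pairs r p q)) ?H tableau_of"
    unfolding commutes_with_ops_def
  proof (intro ballI)
    fix z k assume "z \<in> elems (pair_crystal (cartan_pairs r p q))"
    then obtain A B where z: "z = (A, B)" "(A, B) \<in> pairs r p q"
      by (cases z) (simp add: cartan_pairs_def level_def)
    have fin: "finite A" "finite B" using z(2) pairs_finite by blast+
    have col_phi: "phi ?A k (col A) = of_bool (k \<in> A \<and> Suc k \<notin> A)"
      by (subst phi_def, subst greatest_iter_square_zero)
        (use fin in \<open>auto simp: column_ops split: if_splits\<close>)
    have H: "wt ?H [b, b'] k = wt ?A b k + wt (tensor_power ?A (Suc 0)) [b'] k"
      "Eop ?H k [b, b'] = (if phi ?A k b \<ge> eps (tensor_power ?A (Suc 0)) k [b']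
        then map_option (\<lambda>x. [x, b']) (Eop ?A k b)
        else map_option ((#) b) (Eop (tensor_power ?A (Suc 0)) k [b']))"
      "Fop ?H k [b, b'] = (if phi ?A k b > eps (tensor_power ?A (Suc 0)) k [b']
        then map_option (\<lambda>x. [x, b']) (Fop ?A k b)
        else map_option ((#) b) (Fop (tensor_power ?A (Suc 0)) k [b']))" for b b'
      unfolding hw_crystal_def subcrystal_simps two tensor_power.simps(2)[of ?A "Suc 0"]
      by (rule cons_tensor_simps)+
    note right_simps = hw_crystal_fund_simps[OF pq(2) fin(2), unfolded right subcrystal_simps]
    show "wt ?H (tableau_of z) k = wt (pair_crystal (cartan_pairs r p q)) z k \<and>
        Eop ?H k (tableau_of z) = map_option tableau_of (Eop (pair_crystal (cartan_pairs r p q)) k z) \<and>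
        Fop ?H k (tableau_of z) = map_option tableau_of (Fop (pair_crystal (cartan_pairs r p q)) k z)"
      unfolding z(1) tableau_of_def case_prod_conv H right_simps col_phi column_ops[OF fin(1)]
      by (auto simp: pairE_def pairF_def content_def)
  qed
  ultimately show ?thesis
    using closed_level by (simp add: strict_bij_def bij_betw_def cartan_pairs_def)
qed

section \<open>The Cartan braiding\<close>

text \<open>This will turn out to be the Cartan braiding. For \<open>p > q\<close> it is the inverse of the map in the
  other direction.\<close>

definition cartan_map :: "nat \<Rightarrow> nat \<Rightarrow> nat \<Rightarrow> nat set \<times> nat set \<Rightarrow> nat set \<times> nat set" where
  "cartan_map r p q =
     (if p \<le> q then step ^^ (q - p) else inv_into (cartan_pairs r q p) (step ^^ (p - q)))"

lemma steps_cartan_strict_bij: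
  assumes "p \<le> q"
  shows "strict_bij {1..r} (pair_crystal (cartan_pairs r p q)) (pair_crystal (cartan_pairs r q p))
    (step ^^ (q - p))"
  using steps_strict_bij[of "q - p" q p r] assms by (simp add: cartan_pairs_def of_nat_diff)

lemma cartan_map_strict_bij:
  "strict_bij {1..r} (pair_crystal (cartan_pairs r p q)) (pair_crystal (cartan_pairs r q p))
    (cartan_map r p q)"
proof (cases "p \<le> q")
  case True
  then show ?thesis using steps_cartan_strict_bij by (simp add: cartan_map_def)
next
  case False
  then show ?thesis
    using strict_bij_inv[OF steps_cartan_strict_bij[of q p r]] by (simp add: cartan_map_def)
qed

text \<open>For \<open>p > q\<close> the pairs are not tableaux of straight shape, and the steps are needed to see that
  they form the same crystal.\<close>

lemma cartan_pairs_strict_bij_hw: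
  assumes pq: "p \<in> {1..r}" "q \<in> {1..r}"
  shows "\<exists>h. strict_bij {1..r} (pair_crystal (cartan_pairs r p q))
    (hw_crystal r (\<lambda>k. fund_wt p k + fund_wt q k)) h"
proof (cases "p \<le> q")
  case True
  then show ?thesis using tableau_of_strict_bij pq by blast
next
  case False
  then have "strict_bij {1..r} (pair_crystal (cartan_pairs r q p))
    (hw_crystal r (\<lambda>k. fund_wt p k + fund_wt q k)) tableau_of"
    using tableau_of_strict_bij[of q r p] pq by (simp add: add.commute)
  then show ?thesis using strict_bij_comp cartan_map_strict_bij by blast
qed

lemma cartan_pairs_sub: "cartan_pairs r p q \<subseteq> pairs r p q"
  by (auto simp: cartan_pairs_def level_def)

lemma encode_cartan_strict_bij:
  assumes "p \<in> {1..r}" "q \<in> {1..r}"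
  shows "strict_bij {1..r} (pair_crystal (cartan_pairs r p q))
    (subcrystal (tensor (hw_crystal r (fund_wt p)) (hw_crystal r (fund_wt q)))
      (encode ` cartan_pairs r p q)) encode"
proof -
  have "closed_crystal {1..r} (pair_crystal (cartan_pairs r p q))"
    unfolding cartan_pairs_def by (rule closed_level)
  then show ?thesis using strict_bij_sub[OF encode_strict_bij[OF assms] cartan_pairs_sub] by simp
qed

lemma encode_cartan_sub:
  assumes "p \<in> {1..r}" "q \<in> {1..r}"
  shows "encode ` cartan_pairs r p q \<subseteq> elems (tensor (hw_crystal r (fund_wt p)) (hw_crystal r (fund_wt q)))"
  unfolding strict_bij_surj[OF encode_strict_bij[OF assms], symmetric] pair_crystal_simps
  by (rule image_mono[OF cartan_pairs_sub])

lemma normal_tensor: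
  assumes "p \<in> {1..r}" "q \<in> {1..r}"
  shows "normal_ops {1..r} (tensor (hw_crystal r (fund_wt p)) (hw_crystal r (fund_wt q)))"
  by (rule normal_ops_transport[OF encode_strict_bij[OF assms]])
    (simp add: normal_ops_def pairF_iff_pairE)

lemma tensor_element_of_highest_weight:
  assumes pq: "p \<in> {1..r}" "q \<in> {1..r}"
    and y: "y \<in> elems (tensor (hw_crystal r (fund_wt p)) (hw_crystal r (fund_wt q)))"
    and wt: "\<And>k. k \<in> {1..r} \<Longrightarrow> wt (tensor (hw_crystal r (fund_wt p)) (hw_crystal r (fund_wt q))) y k =
      content (hw_pair p q) k - content (hw_pair p q) (Suc k)"
  shows "y = encode (hw_pair p q)"
proof -
  note b = encode_strict_bij[OF pq]
  obtain z where z: "z \<in> pairs r p q" "y = encode z"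
    using y strict_bij_surj[OF b] by (metis imageE pair_crystal_simps(1))
  have co: "commutes_with_ops {1..r} (pair_crystal (pairs r p q))
      (tensor (hw_crystal r (fund_wt p)) (hw_crystal r (fund_wt q))) encode"
    using b by (simp add: strict_bij_def)
  have "content z k - content z (Suc k) = content (hw_pair p q) k - content (hw_pair p q) (Suc k)"
    if "k \<in> {1..r}" for k
    using commutes_with_opsD(1)[OF co _ that, of z] wt[OF that] z by simp
  then show ?thesis using hw_weight_unique[OF z(1) pq] z(2) by simp
qed

text \<open>A component isomorphic to the crystal of highest weight \<open>\<omega>\<^sub>p + \<omega>\<^sub>q\<close> contains an element of this
  weight. There is only one in the whole tensor product, so the component is the one generated by it.\<close>

lemma cartan_component_eq:
  assumes pq: "p \<in> {1..r}" "q \<in> {1..r}"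
  shows "cartan_component r (fund_wt p) (fund_wt q) = encode ` cartan_pairs r p q"
    and "generated_by {1..r} (subcrystal (tensor (hw_crystal r (fund_wt p)) (hw_crystal r (fund_wt q)))
      (encode ` cartan_pairs r p q)) (encode (hw_pair p q))"
proof -
  let ?T = "tensor (hw_crystal r (fund_wt p)) (hw_crystal r (fund_wt q))"
  let ?H = "hw_crystal r (\<lambda>k. fund_wt p k + fund_wt q k)"
  let ?S = "encode ` cartan_pairs r p q" and ?u = "encode (hw_pair p q)"
  note enc = encode_cartan_strict_bij[OF pq]
  note sub = encode_cartan_sub[OF pq]
  show gen: "generated_by {1..r} (subcrystal ?T ?S) ?u"
    using generated_by_transport[OF enc cartan_pairs_generated] pq by simp
  note comp = generated_stable_set_is_component[OF sub closed_crystal_target[OF enc] normal_tensor[OF pq] gen]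
  obtain h where h: "strict_bij {1..r} (pair_crystal (cartan_pairs r p q)) ?H h"
    using cartan_pairs_strict_bij_hw[OF pq] by blast
  have "\<exists>\<psi>. crystal_iso {1..r} (subcrystal ?T ?S) ?H \<psi>"
    using crystal_iso_of_strict_bij[OF strict_bij_comp[OF strict_bij_inv[OF enc] h]] by blast
  moreover have "C = ?S"
    if C: "C \<in> connected_components {1..r} ?T" and \<psi>: "crystal_iso {1..r} (subcrystal ?T C) ?H \<psi>" for C \<psi>
  proof -
    have hw: "hw_pair p q \<in> cartan_pairs r p q" using pq by (simp add: hw_pair_cartan)
    have "h (hw_pair p q) \<in> elems ?H" using strict_bij_image[OF h] hw by simp
    then obtain y where y: "y \<in> C" "\<psi> y = Some (h (hw_pair p q))"
      using \<psi> by (fastforce simp: crystal_iso_def bij_betw_def image_iff)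
    have co: "commutes_with_ops {1..r} (pair_crystal (cartan_pairs r p q)) ?H h"
      using h by (simp add: strict_bij_def)
    have "wt ?T y k = content (hw_pair p q) k - content (hw_pair p q) (Suc k)" if "k \<in> {1..r}" for k
    proof -
      have "wt ?H (h (hw_pair p q)) k = wt ?T y k"
        using \<psi> y that by (simp add: crystal_iso_def crystal_morphism_def)
      then show ?thesis using commutes_with_opsD(1)[OF co _ that] hw by simp
    qed
    moreover have "y \<in> elems ?T" using component_subset[OF C] y(1) by blast
    ultimately have "y = ?u" using tensor_element_of_highest_weight[OF pq] by blast
    then show ?thesis using component_containing[OF C] y(1) comp(1) by simp
  qed
  ultimately show "cartan_component r (fund_wt p) (fund_wt q) = ?S"
    unfolding cartan_component_def using comp(2) by (intro the_equality) blast+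
qed

text \<open>Any isomorphism of the Cartan components preserves weights, hence maps the unique element of highest
  weight to the unique element of highest weight, and is thereby determined.\<close>

lemma cartan_braiding_eq:
  assumes pq: "p \<in> {1..r}" "q \<in> {1..r}" and z: "z \<in> cartan_pairs r p q"
  shows "cartan_braiding r (fund_wt p) (fund_wt q) (encode z) = Some (encode (cartan_map r p q z))"
proof -
  let ?T = "tensor (hw_crystal r (fund_wt p)) (hw_crystal r (fund_wt q))"
  let ?T' = "tensor (hw_crystal r (fund_wt q)) (hw_crystal r (fund_wt p))"
  let ?S = "encode ` cartan_pairs r p q" and ?S' = "encode ` cartan_pairs r q p"
  let ?u = "encode (hw_pair p q)" and ?u' = "encode (hw_pair q p)"
  let ?g = "encode \<circ> cartan_map r p q \<circ> inv_into (cartan_pairs r p q) encode"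
  define \<sigma> where "\<sigma> = (\<lambda>x. if x \<in> ?S then Some (?g x) else None)"
  note enc = encode_cartan_strict_bij[OF pq] and enc' = encode_cartan_strict_bij[OF pq(2,1)]
  have g: "strict_bij {1..r} (subcrystal ?T ?S) (subcrystal ?T' ?S') ?g"
    using strict_bij_comp[OF strict_bij_inv[OF enc] strict_bij_comp[OF cartan_map_strict_bij enc']]
    by (simp add: comp_assoc)
  note sub = encode_cartan_sub[OF pq] and sub' = encode_cartan_sub[OF pq(2,1)]
  have closed: "closed_crystal {1..r} (subcrystal ?T ?S)" using g by (simp add: strict_bij_def)
  have gen: "generated_by {1..r} (subcrystal ?T ?S) ?u" by (rule cartan_component_eq(2)[OF pq])
  have iso: "crystal_iso {1..r} (subcrystal ?T ?S) (subcrystal ?T' ?S') \<sigma>"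
    using crystal_iso_of_strict_bij[OF g] by (simp add: \<sigma>_def)
  have morphism: "crystal_morphism {1..r} ?T ?T' \<sigma>"
    unfolding \<sigma>_def
  proof (rule crystal_morphism_extend_by_zero)
    show "closed_crystal {1..r} (subcrystal ?T ?S)" by (rule closed)
    show "commutes_with_ops {1..r} (subcrystal ?T ?S) ?T' ?g"
      using g by (simp add: strict_bij_def commutes_with_ops_def)
    show "?g x \<in> elems ?T'" if "x \<in> ?S" for x
      using subsetD[OF sub', of "?g x"] strict_bij_image[OF g, of x] that by (simp only: subcrystal_simps)
    show "x \<in> ?S" if x: "x \<in> elems ?T" "k \<in> {1..r}" "Eop ?T k x = Some y \<or> Fop ?T k x = Some y" "y \<in> ?S" for x k y
      using normal_opsD[OF normal_tensor[OF pq] x(1,2), of y] closed_crystalD[OF closed _ x(2), of y x] x(3,4)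
      by auto
  qed
  have "\<tau> = \<sigma>"
    if \<tau>: "crystal_morphism {1..r} ?T ?T' \<tau>" "crystal_iso {1..r} (subcrystal ?T ?S) (subcrystal ?T' ?S') \<tau>"
      "\<forall>x. x \<notin> ?S \<longrightarrow> \<tau> x = None" for \<tau>
  proof
    fix x
    have top: "\<rho> ?u = Some ?u'" if \<rho>: "crystal_iso {1..r} (subcrystal ?T ?S) (subcrystal ?T' ?S') \<rho>" for \<rho>
    proof -
      have u: "?u \<in> ?S" using gen by (simp add: generated_by_def)
      then obtain y where y: "\<rho> ?u = Some y" "y \<in> ?S'" "\<forall>k \<in> {1..r}. wt ?T' y k = wt ?T ?u k"
        using crystal_isoD[OF \<rho>, of ?u] unfolding subcrystal_simps by blast
      have "wt ?T ?u k = content (hw_pair q p) k - content (hw_pair q p) (Suc k)" if "k \<in> {1..r}" for k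
        using encode_cartan_strict_bij[OF pq] hw_pair_cartan[of p r q] pq that
        by (simp add: strict_bij_def commutes_with_ops_def) (simp add: content_def hw_pair_def)
      then have "y = ?u'"
        using tensor_element_of_highest_weight[OF pq(2,1)] subsetD[OF sub' y(2)] y(3) by simp
      then show ?thesis using y by simp
    qed
    show "\<tau> x = \<sigma> x"
    proof (cases "x \<in> ?S")
      case True
      then show ?thesis
        using morphisms_agree_on_generated[OF gen sub \<tau>(1) morphism] top[OF \<tau>(2)] top[OF iso] by simp
    next
      case False
      then have "\<tau> x = None" using \<tau>(3) by blast
      then show ?thesis by (simp only: \<sigma>_def False if_False)
    qed
  qed
  moreover have "\<forall>x. x \<notin> ?S \<longrightarrow> \<sigma> x = None" by (simp add: \<sigma>_def)
  ultimately have "cartan_braiding r (fund_wt p) (fund_wt q) = \<sigma>"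
    unfolding cartan_braiding_def cartan_component_eq(1)[OF pq] cartan_component_eq(1)[OF pq(2,1)]
    using morphism iso by (intro the_equality) blast+
  moreover have "inv_into (cartan_pairs r p q) encode (encode z) = z"
    using enc z by (simp add: strict_bij_def bij_betw_def)
  ultimately show ?thesis using z by (simp add: \<sigma>_def)
qed

section \<open>Jeu de taquin on two columns\<close>

text \<open>The effect on a filling of a hole that rises in column \<open>b\<close> from row \<open>n\<close> to row \<open>m\<close>, and in
  \<open>shift_up\<close> of a hole that sinks from row \<open>n\<close> to row \<open>m\<close>.\<close>

definition shift_down :: "filling \<Rightarrow> nat \<Rightarrow> nat \<Rightarrow> nat \<Rightarrow> filling" where
  "shift_down T b m n = (\<lambda>(a, c).
     if c = b \<and> m \<le> a \<and> a \<le> n then (if a = m then None else T (a - 1, c)) else T (a, c))"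

definition shift_up :: "filling \<Rightarrow> nat \<Rightarrow> nat \<Rightarrow> nat \<Rightarrow> filling" where
  "shift_up T b n m = (\<lambda>(a, c).
     if c = b \<and> n \<le> a \<and> a \<le> m then (if a = m then None else T (Suc a, c)) else T (a, c))"

lemma shift_down_trivial: "T (n, b) = None \<Longrightarrow> shift_down T b n n = T"
  by (auto simp: shift_down_def fun_eq_iff)

lemma shift_up_trivial: "T (n, b) = None \<Longrightarrow> shift_up T b n n = T"
  by (auto simp: shift_up_def fun_eq_iff)

lemma shift_down_step:
  assumes "m \<le> n" "T (n, b) = Some y"
  shows "shift_down (T((Suc n, b) := Some y, (n, b) := None)) b m n = shift_down T b m (Suc n)"
proof (rule ext, clarify)
  fix a c
  consider "c \<noteq> b" | "c = b" "a = Suc n" | "c = b" "Suc n < a" | "c = b" "a < m" |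
    "c = b" "a = m" | "c = b" "m < a" "a \<le> n"
    by linarith
  then show "shift_down (T((Suc n, b) := Some y, (n, b) := None)) b m n (a, c) =
      shift_down T b m (Suc n) (a, c)"
    by cases (use assms in \<open>auto simp: shift_down_def\<close>)
qed

lemma shift_up_step:
  assumes "n < m" "T (Suc n, b) = Some y"
  shows "shift_up (T((n, b) := Some y, (Suc n, b) := None)) b (Suc n) m = shift_up T b n m"
proof (rule ext, clarify)
  fix a c
  consider "c \<noteq> b" | "c = b" "a = n" | "c = b" "a < n" | "c = b" "m < a" |
    "c = b" "a = m" | "c = b" "n < a" "a < m"
    by linarith
  then show "shift_up (T((n, b) := Some y, (Suc n, b) := None)) b (Suc n) m (a, c) =
      shift_up T b n m (a, c)"
    by cases (use assms in \<open>simp_all add: shift_up_def\<close>)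
qed

text \<open>A whole vertical stretch of a slide at once: the hole stays in its column as long as the
  competing horizontal neighbour loses.\<close>

lemma slide_out_within_column:
  assumes "c = Suc b" "m \<le> n" "T (n, c) = None"
    and "\<And>h. m \<le> h \<Longrightarrow> h < n \<Longrightarrow>
      \<exists>y. T (h, c) = Some y \<and> (\<forall>x. T (Suc h, b) = Some x \<longrightarrow> x \<le> y)"
    and "slide_out (m, c) (shift_down T c m n) T'"
  shows "slide_out (n, c) T T'"
  using assms(2-) unfolding assms(1)
proof (induction n arbitrary: T rule: dec_induct)
  case base
  then show ?case using shift_down_trivial[of T m "Suc b"] by simp
next
  case (step n)
  obtain y where y: "T (n, Suc b) = Some y" "\<forall>x. T (Suc n, b) = Some x \<longrightarrow> x \<le> y"
    using step.prems(2)[OF step.hyps(1) lessI] by blast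
  let ?T = "T((Suc n, Suc b) := Some y, (n, Suc b) := None)"
  have slide: "slide_out (n, Suc b) ?T T'"
  proof (rule step.IH)
    show "\<exists>y. ?T (h, Suc b) = Some y \<and> (\<forall>x. ?T (Suc h, b) = Some x \<longrightarrow> x \<le> y)" if "m \<le> h" "h < n" for h
      using step.prems(2)[of h] that by simp
    show "slide_out (m, Suc b) (shift_down ?T (Suc b) m n) T'"
      using step.prems(3) shift_down_step[of m n T "Suc b" y] step.hyps(1) y(1) by simp
  qed simp
  show ?case by (rule slide_out.down[of T n b y T', OF y(1) _ slide]) (use y(2) in simp)
qed

lemma slide_in_within_column:
  assumes "c = Suc b" "n \<le> m" "T (n, b) = None"
    and "\<And>h. n \<le> h \<Longrightarrow> h < m \<Longrightarrow>
      \<exists>y. T (Suc h, b) = Some y \<and> (\<forall>x. T (h, c) = Some x \<longrightarrow> y \<le> x)"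
    and "slide_in (m, b) (shift_up T b n m) T'"
  shows "slide_in (n, b) T T'"
  using assms(2-) unfolding assms(1)
proof (induction n arbitrary: T rule: inc_induct)
  case base
  then show ?case using shift_up_trivial[of T m b] by simp
next
  case (step n)
  obtain y where y: "T (Suc n, b) = Some y" "\<forall>x. T (n, Suc b) = Some x \<longrightarrow> y \<le> x"
    using step.prems(2)[OF order_refl step.hyps(2)] by blast
  let ?T = "T((n, b) := Some y, (Suc n, b) := None)"
  have slide: "slide_in (Suc n, b) ?T T'"
  proof (rule step.IH)
    show "\<exists>y. ?T (Suc h, b) = Some y \<and> (\<forall>x. ?T (h, Suc b) = Some x \<longrightarrow> y \<le> x)" if "Suc n \<le> h" "h < m" for h
      using step.prems(2)[of h] that by simp
    show "slide_in (m, b) (shift_up ?T b (Suc n) m) T'"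
      using step.prems(3) shift_up_step[of n m T b y] step.hyps(2) y(1) by simp
  qed simp
  show ?case by (rule slide_in.up[of T n b y T', OF y(1) _ slide]) (use y(2) in simp)
qed

text \<open>The result of a slide on two columns in which the entry of the left column in row \<open>m\<close> changes to the
  right column. The left column starts in row \<open>t + 1\<close>, and \<open>n\<close> is the first empty row of the
  right column.\<close>

definition cross_over :: "filling \<Rightarrow> nat \<Rightarrow> nat \<Rightarrow> nat \<Rightarrow> filling" where
  "cross_over T t m n = (\<lambda>(a, c).
     if c = 2 then
       (if a < m then T (a, 2) else if a = m then T (m, 1) else if a \<le> n then T (a - 1, 2) else None)
     else if c = 1 then
       (if a \<le> Suc t then None else if a \<le> m then T (a - 1, 1) else T (a, 1))
     else None)"

text \<open>Each comparison along the path is an instance of semistandardness of one of the two fillings: in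
  the outward slide, the hole rises in the right column because the pairs of entries compared are
  neighbours in the resulting filling, and it changes to the left column because the right column of
  that filling is strict. For the inward slide the roles of the two fillings are exchanged.\<close>

lemma slides_cross_over:
  assumes tm: "t < m" and mn: "m \<le> n"
    and cols: "\<And>a c. c \<noteq> 1 \<Longrightarrow> c \<noteq> 2 \<Longrightarrow> T (a, c) = None"
    and right_end: "\<And>a. n \<le> a \<Longrightarrow> T (a, 2) = None" and left_end: "\<And>a. a \<le> t \<Longrightarrow> T (a, 1) = None"
    and right: "\<And>a. m \<le> a \<Longrightarrow> a < n \<Longrightarrow> T (a, 2) \<noteq> None"
    and left: "\<And>a. t < a \<Longrightarrow> a \<le> m \<Longrightarrow> T (a, 1) \<noteq> None"
    and ss: "semistandard T" and ss': "semistandard (cross_over T t m n)"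
  shows "slide_out (n, 2) T (cross_over T t m n)"
    and "slide_in (Suc t, 1) (cross_over T t m n) T"
proof -
  let ?T' = "cross_over T t m n"
  have row: "x \<le> y" if "semistandard U" "U (a, 1) = Some x" "U (a, 2) = Some y" for U a x y
    using that unfolding semistandard_def by (meson one_less_numeral_iff semiring_norm(76))
  have column: "x < y" if "semistandard U" "U (a, b) = Some x" "U (a', b) = Some y" "a < a'" for U a a' b x y
    using that unfolding semistandard_def by meson
  obtain x where x: "T (m, 1) = Some x" using left[of m] tm by auto
  obtain m' where m': "m = Suc m'" using tm by (cases m) auto
  have T': "?T' (a, 2) = (if a < m then T (a, 2) else if a = m then T (m, 1) else if a \<le> n then T (a - 1, 2) else None)"
    "?T' (a, 1) = (if a \<le> Suc t then None else if a \<le> m then T (a - 1, 1) else T (a, 1))"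
    "c \<noteq> 1 \<Longrightarrow> c \<noteq> 2 \<Longrightarrow> ?T' (a, c) = None" for a c
    by (simp_all add: cross_over_def)
  note T'' = T' T'(2)[unfolded One_nat_def]
  have three: "Suc (Suc 0) = 2" "Suc 2 = 3" by simp_all
  show "slide_out (n, 2) T ?T'"
  proof -
    \<comment> \<open>\<open>T1\<close> is the filling when the hole has reached row \<open>m\<close> of the right column, and \<open>T2\<close> the one
      after the change to the left column.\<close>
    define T1 where "T1 = shift_down T 2 m n"
    define T2 where "T2 = T1((m, 2) := Some x, (m, 1) := None)"
    have T2: "T2 (a, 2) = ?T' (a, 2)" "T2 (a, 1) = (if a = m then None else T (a, 1))"
      "c \<noteq> 1 \<Longrightarrow> c \<noteq> 2 \<Longrightarrow> T2 (a, c) = None" for a c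
      using mn x right_end[of a] cols by (auto simp: T'' T1_def T2_def shift_down_def)
    have "shift_down T2 1 (Suc t) m (a, c) = ?T' (a, c)" for a c
    proof -
      consider "c = 2" | "c = 1" "a \<le> t" | "c = 1" "a = Suc t" | "c = 1" "Suc t < a" "a \<le> m" |
        "c = 1" "m < a" | "c \<noteq> 1" "c \<noteq> 2"
        by linarith
      then show ?thesis
        by cases (use tm T2 T' left_end[of a] in \<open>auto simp: shift_down_def\<close>)
    qed
    then have "shift_down T2 1 (Suc t) m = ?T'" by (simp add: fun_eq_iff)
    moreover have "slide_out (Suc t, 1) ?T' ?T'"
      using slide_out.stop[of ?T' t 0] T'(2)[of t] T'(3)[of 0 "Suc t"] by simp
    moreover have "\<exists>y. T2 (h, 1) = Some y \<and> (\<forall>x. T2 (Suc h, 0) = Some x \<longrightarrow> x \<le> y)"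
      if "Suc t \<le> h" "h < m" for h
      using left[of h] that T2(2)[of h] T2(3)[of 0 "Suc h"] by auto
    moreover have "T2 (m, 1) = None" using T2(2)[of m] by simp
    ultimately have "slide_out (m, 1) T2 ?T'"
      using slide_out_within_column[of 1 0 "Suc t" m T2 ?T'] tm by fastforce
    moreover have "y < x" if "T1 (m', 2) = Some y" for y
    proof -
      have "?T' (m', 2) = Some y" "?T' (m, 2) = Some x"
        using that x T'(1)[of m'] T'(1)[of m] by (simp_all add: m' T1_def shift_down_def)
      then show ?thesis using column[OF ss'] m' by blast
    qed
    moreover have "T1 (m, 1) = Some x" using x by (simp add: T1_def shift_down_def)
    ultimately have "slide_out (m, 2) T1 ?T'"
      using slide_out.right[of T1 m' 1 x ?T'] unfolding T2_def m' One_nat_def three by blast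
    moreover have "\<exists>y. T (h, 2) = Some y \<and> (\<forall>x. T (Suc h, 1) = Some x \<longrightarrow> x \<le> y)" if "m \<le> h" "h < n" for h
    proof -
      have "T (h, 2) \<noteq> None" using right that by simp
      then obtain y where y: "T (h, 2) = Some y" by blast
      then have "?T' (Suc h, 2) = Some y" "?T' (Suc h, 1) = T (Suc h, 1)"
        using that tm T'(1)[of "Suc h"] T'(2)[of "Suc h"] by simp_all
      then show ?thesis using row[OF ss', of "Suc h"] y by auto
    qed
    ultimately show ?thesis
      using slide_out_within_column[of 2 1 m n T ?T'] mn right_end[of n] unfolding T1_def by simp
  qed
  show "slide_in (Suc t, 1) ?T' T"
  proof -
    \<comment> \<open>\<open>U1\<close> is the filling when the hole has reached row \<open>m\<close> of the left column, and \<open>U2\<close> the one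
      after the change to the right column.\<close>
    define U1 where "U1 = shift_up ?T' 1 (Suc t) m"
    define U2 where "U2 = U1((m, 1) := Some x, (m, 2) := None)"
    have U2: "U2 (a, 2) = (if a = m then None else ?T' (a, 2))" "U2 (a, 1) = T (a, 1)"
      "c \<noteq> 1 \<Longrightarrow> c \<noteq> 2 \<Longrightarrow> U2 (a, c) = None" for a c
      using tm x left_end[of a] by (auto simp: T'' U1_def U2_def shift_up_def)
    have "shift_up U2 2 m n (a, c) = T (a, c)" for a c
    proof -
      consider "c = 1" | "c = 2" "a < m" | "c = 2" "m \<le> a" "a < n" | "c = 2" "a = n" | "c = 2" "n < a" |
        "c \<noteq> 1" "c \<noteq> 2"
        by linarith
      then show ?thesis
        by cases (use mn U2 T' right_end[of a] cols[of c a] in \<open>auto simp: shift_up_def\<close>)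
    qed
    then have "shift_up U2 2 m n = T" by (simp add: fun_eq_iff)
    moreover have "slide_in (n, 2) T T"
      using slide_in.stop[of T n 2] right_end[of "Suc n"] cols[of 3 n] by simp
    moreover have "\<exists>y. U2 (Suc h, 2) = Some y \<and> (\<forall>x. U2 (h, 3) = Some x \<longrightarrow> y \<le> x)"
      if "m \<le> h" "h < n" for h
      unfolding U2 using right[OF that] that by (auto simp: T'(1) U2(3))
    ultimately have "slide_in (m, 2) U2 T"
      using slide_in_within_column[of 3 2 m n U2 T] mn U2(1)[of m] by simp
    moreover have "x < y" if "U1 (Suc m, 1) = Some y" for y
      using column[OF ss x, of "Suc m" y] that tm by (simp add: U1_def shift_up_def T'')
    moreover have "U1 (m, 2) = Some x" using x by (simp add: U1_def shift_up_def T'(1))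
    ultimately have "slide_in (m, 1) U1 T"
      using slide_in.left[of U1 m 1 x T] unfolding U2_def One_nat_def three by blast
    moreover have "\<exists>y. ?T' (Suc h, 1) = Some y \<and> (\<forall>x. ?T' (h, 2) = Some x \<longrightarrow> y \<le> x)" if "Suc t \<le> h" "h < m" for h
    proof -
      have "T (h, 1) \<noteq> None" using left that by simp
      then obtain y where y: "T (h, 1) = Some y" by blast
      moreover have "?T' (Suc h, 1) = T (h, 1)" "?T' (h, 2) = T (h, 2)"
        using that by (simp_all add: T'')
      ultimately show ?thesis using row[OF ss y] by auto
    qed
    moreover have "?T' (Suc t, 1) = None" "Suc t \<le> m" using tm by (simp_all add: T'')
    ultimately show ?thesis
      using slide_in_within_column[of 2 1 "Suc t" m ?T' T] unfolding U1_def by simp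
  qed
qed

definition skew_filling :: "nat list \<Rightarrow> nat list \<Rightarrow> nat \<Rightarrow> filling" where
  "skew_filling R L t = (\<lambda>(a, c).
     if c = 2 \<and> 1 \<le> a \<and> a \<le> length R then Some (R ! (a - 1))
     else if c = 1 \<and> t < a \<and> a \<le> t + length L then Some (L ! (a - t - 1))
     else None)"

lemma two_column_eq: "two_column b b' = skew_filling b b' (length b - length b')"
  by (simp add: two_column_def skew_filling_def Let_def)

lemma skew_filling_2: "skew_filling R L t (a, 2) = (if 1 \<le> a \<and> a \<le> length R then Some (R ! (a - 1)) else None)"
  and skew_filling_1: "skew_filling R L t (a, 1) =
    (if t < a \<and> a \<le> t + length L then Some (L ! (a - t - 1)) else None)"
  and skew_filling_other: "c \<noteq> 1 \<Longrightarrow> c \<noteq> 2 \<Longrightarrow> skew_filling R L t (a, c) = None"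
  by (simp_all add: skew_filling_def)

lemma semistandard_skew_filling:
  assumes "sorted_wrt (<) R" "sorted_wrt (<) L"
    and dom: "\<And>k. t + k < length R \<Longrightarrow> k < length L \<Longrightarrow> L ! k \<le> R ! (t + k)"
  shows "semistandard (skew_filling R L t)"
  unfolding semistandard_def
proof (intro conjI allI impI)
  fix a b b' x y
  assume "b < b'" "skew_filling R L t (a, b) = Some x" "skew_filling R L t (a, b') = Some y"
  then have "b = 1" "b' = 2" by (auto simp: skew_filling_def split: if_splits)
  then have "t < a" "a \<le> t + length L" "x = L ! (a - t - 1)" "a \<le> length R" "y = R ! (a - 1)"
    using \<open>skew_filling R L t (a, b) = Some x\<close> \<open>skew_filling R L t (a, b') = Some y\<close>
    by (auto simp: skew_filling_def split: if_splits)
  then show "x \<le> y" using dom[of "a - t - 1"] by simp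
next
  fix a a' b x y
  assume "a < a'" "skew_filling R L t (a, b) = Some x" "skew_filling R L t (a', b) = Some y"
  then show "x < y"
    using sorted_wrt_nth_less[OF assms(1), of "a - 1" "a' - 1"]
      sorted_wrt_nth_less[OF assms(2), of "a - t - 1" "a' - t - 1"]
    by (auto simp: skew_filling_def split: if_splits)
qed

lemma skew_filling_cross_over:
  assumes "length R1 = t + length L1"
  shows "cross_over (skew_filling (R1 @ R2) (L1 @ x # L2) t) t (Suc (length R1)) (Suc (length R1 + length R2)) =
    skew_filling (R1 @ x # R2) (L1 @ L2) (Suc t)"
proof (rule ext, clarify)
  fix a c :: nat
  consider "c = 2" | "c = 1" | "c \<noteq> 1" "c \<noteq> 2" by blast
  then show "cross_over (skew_filling (R1 @ R2) (L1 @ x # L2) t) t (Suc (length R1)) (Suc (length R1 + length R2)) (a, c) =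
      skew_filling (R1 @ x # R2) (L1 @ L2) (Suc t) (a, c)"
  proof cases
    case 1
    then show ?thesis using assms
      by (auto simp: cross_over_def skew_filling_1[unfolded One_nat_def] skew_filling_2 nth_append nth_Cons')
  next
    case 2
    then show ?thesis using assms
      by (auto simp: cross_over_def skew_filling_1[unfolded One_nat_def] skew_filling_2 nth_append nth_Cons')
  next
    case 3
    then show ?thesis by (simp add: cross_over_def skew_filling_other)
  qed
qed

text \<open>The diagram with column lengths \<open>n\<close> and \<open>p\<close>. It serves as outer diagram, and for \<open>p = 0\<close> as the
  inner diagram consisting of the cells above the left column.\<close>

definition skew_outer :: "nat \<Rightarrow> nat \<Rightarrow> (nat \<times> nat) set" where
  "skew_outer p n = {1..n} \<times> {1} \<union> {1..p} \<times> {2}"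

lemma young_diagram_skew_outer: "p \<le> n \<Longrightarrow> young_diagram (skew_outer p n)"
  by (auto simp: young_diagram_def skew_outer_def le_Suc_eq numeral_2_eq_2)

lemma dom_skew_filling:
  "dom (skew_filling R L t) = skew_outer (length R) (t + length L) - skew_outer 0 t"
  by (auto simp: skew_outer_def skew_filling_def split: if_splits)

lemma jdt_slides_skew_filling:
  assumes len: "length R1 = t + length L1" "length R2 \<le> length L2"
    and ss: "semistandard (skew_filling (R1 @ R2) (L1 @ x # L2) t)"
    and ss': "semistandard (skew_filling (R1 @ x # R2) (L1 @ L2) (Suc t))"
  shows "jdt_slide (skew_filling (R1 @ R2) (L1 @ x # L2) t) (skew_filling (R1 @ x # R2) (L1 @ L2) (Suc t))"
    and "jdt_slide (skew_filling (R1 @ x # R2) (L1 @ L2) (Suc t)) (skew_filling (R1 @ R2) (L1 @ x # L2) t)"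
proof -
  let ?T = "skew_filling (R1 @ R2) (L1 @ x # L2) t" and ?T' = "skew_filling (R1 @ x # R2) (L1 @ L2) (Suc t)"
  let ?m = "Suc (length R1)" and ?n = "Suc (length R1 + length R2)" and ?N = "Suc (t + (length L1 + length L2))"
  have "slide_out (?n, 2) ?T (cross_over ?T t ?m ?n) \<and> slide_in (Suc t, 1) (cross_over ?T t ?m ?n) ?T"
    by (intro conjI slides_cross_over)
      (use len ss ss' skew_filling_cross_over[OF len(1), of R2 x L2] in
        \<open>simp_all add: skew_filling_1[unfolded One_nat_def] skew_filling_2 skew_filling_other\<close>)
  then have slides: "slide_out (?n, 2) ?T ?T'" "slide_in (Suc t, 1) ?T' ?T"
    using skew_filling_cross_over[OF len(1), of R2 x L2] by simp_all
  have le: "length R1 + length R2 < ?N" using len by simp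
  have dom: "dom ?T = skew_outer (length R1 + length R2) ?N - skew_outer 0 t"
    "dom ?T' = skew_outer (Suc (length R1 + length R2)) ?N - skew_outer 0 (Suc t)"
    using dom_skew_filling[of "R1 @ R2" "L1 @ x # L2" t] dom_skew_filling[of "R1 @ x # R2" "L1 @ L2" "Suc t"]
    by simp_all
  have sub: "skew_outer 0 s \<subseteq> skew_outer p ?N" if "s \<le> Suc t" for s p
    using that by (auto simp: skew_outer_def)
  have "(?n, 2) \<notin> skew_outer (length R1 + length R2) ?N"
    "insert (?n, 2) (skew_outer (length R1 + length R2) ?N) = skew_outer ?n ?N"
    by (auto simp: skew_outer_def)
  then show "jdt_slide ?T ?T'"
    unfolding jdt_slide_def using ss slides(1) dom(1) sub[of t] young_diagram_skew_outer le
    by (intro conjI exI[of _ "skew_outer (length R1 + length R2) ?N"] exI[of _ "skew_outer 0 t"]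
        exI[of _ "(?n, 2)"]) auto
  have "(Suc t, 1) \<in> skew_outer 0 (Suc t)" "skew_outer 0 (Suc t) - {(Suc t, 1)} = skew_outer 0 t"
    by (auto simp: skew_outer_def)
  then show "jdt_slide ?T' ?T"
    unfolding jdt_slide_def using ss' slides(2) dom(2) sub[of "Suc t"] young_diagram_skew_outer le
    by (intro conjI exI[of _ "skew_outer (Suc (length R1 + length R2)) ?N"] exI[of _ "skew_outer 0 (Suc t)"]
        exI[of _ "(Suc t, 1)"]) auto
qed

definition stage_filling :: "nat \<Rightarrow> nat set \<times> nat set \<Rightarrow> filling" where
  "stage_filling t z = skew_filling (col (fst z)) (col (snd z)) t"

lemma semistandard_stage_filling:
  assumes "z \<in> level r p q (- int t)"
  shows "semistandard (stage_filling t z)"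
proof -
  obtain A B where AB: "z = (A, B)" by (metis surj_pair)
  have z: "(A, B) \<in> pairs r p q" and low: "\<forall>v. - int t \<le> excess (A, B) v"
    using assms by (auto simp: AB level_def min_excess_def)
  have "p \<le> q + t" using spec[OF low, of "r + 1"] excess_total[OF z, of "r + 1"] by simp
  then have "\<forall>k. t + k < p \<longrightarrow> col B ! k \<le> col A ! (t + k)"
    using excess_bound_iff_dominates[OF z] low by blast
  then show ?thesis
    unfolding stage_filling_def using z
    by (intro semistandard_skew_filling) (auto simp: AB pairs_def)
qed

lemma col_split_absent:
  assumes "finite A" "x \<notin> A"
  shows "col A = col (A \<inter> {..<x}) @ col (A \<inter> {x<..})"
proof (rule col_unique[symmetric])
  show "sorted_wrt (<) (col (A \<inter> {..<x}) @ col (A \<inter> {x<..}))"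
    using assms by (auto simp: sorted_wrt_append)
  show "set (col (A \<inter> {..<x}) @ col (A \<inter> {x<..})) = A"
    using assms by (auto simp: not_less_iff_gr_or_eq)
qed

lemma col_split_present:
  assumes "finite A" "x \<in> A"
  shows "col A = col (A \<inter> {..<x}) @ x # col (A \<inter> {x<..})"
proof (rule col_unique[symmetric])
  show "sorted_wrt (<) (col (A \<inter> {..<x}) @ x # col (A \<inter> {x<..}))"
    using assms by (auto simp: sorted_wrt_append)
  show "set (col (A \<inter> {..<x}) @ x # col (A \<inter> {x<..})) = A"
    using assms by (auto simp: not_less_iff_gr_or_eq)
qed

text \<open>The rows match: just before \<open>x\<close> the walk has its minimum \<open>-t\<close>, so \<open>A\<close> has \<open>t\<close> more entries below
  \<open>x\<close> than \<open>B\<close>. As the left column starts \<open>t\<close> rows lower, \<open>x\<close> stands in the row in which it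
  has to be inserted into the right column.\<close>

lemma step_is_jdt_slide:
  assumes z: "z \<in> level r p q (- int t)" and pq: "p < q + t"
  shows "jdt_slide (stage_filling t z) (stage_filling (Suc t) (step z))"
    and "jdt_slide (stage_filling (Suc t) (step z)) (stage_filling t z)"
proof -
  have m: "- int t < int q - int p" using pq by simp
  obtain x where x: "crossing z x" "excess z (x - 1) = - int t" using level_crossing[OF z m] by blast
  obtain A B where AB: "z = (A, B)" by (metis surj_pair)
  note mem = crossing_mem[OF x(1)[unfolded AB]]
  have z': "(A, B) \<in> pairs r p q" using z by (simp add: AB level_def)
  have fin: "finite A" "finite B" using z' pairs_finite by blast+
  have no0: "0 \<notin> A" "0 \<notin> B" and card: "card A = p" "card B = q" using z' by (auto simp: pairs_def)
  let ?R1 = "col (A \<inter> {..<x})" and ?R2 = "col (A \<inter> {x<..})"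
  let ?L1 = "col (B \<inter> {..<x})" and ?L2 = "col (B \<inter> {x<..})"
  have R: "col A = ?R1 @ ?R2" and L: "col B = ?L1 @ x # ?L2"
    using col_split_absent col_split_present fin mem by blast+
  have "col (insert x A) = ?R1 @ x # ?R2" "col (B - {x}) = ?L1 @ ?L2"
    using col_split_present[of "insert x A" x] col_split_absent[of "B - {x}" x] fin
    by (simp_all add: Int_insert_left Diff_Int_distrib2)
  then have T': "stage_filling (Suc t) (step z) = skew_filling (?R1 @ x # ?R2) (?L1 @ ?L2) (Suc t)"
    unfolding step_eq[OF x(1)] by (simp add: stage_filling_def transfer_def AB)
  have T: "stage_filling t z = skew_filling (?R1 @ ?R2) (?L1 @ x # ?L2) t"
    by (simp add: stage_filling_def AB R L)
  have below: "C \<inter> {1..x - 1} = C \<inter> {..<x}" if "0 \<notin> C" for C :: "nat set"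
  proof -
    have "a \<noteq> 0" if "a \<in> C" for a using that \<open>0 \<notin> C\<close> by metis
    then show ?thesis using mem(3) by fastforce
  qed
  have "int (length ?L1) - int (length ?R1) = - int t"
    using x(2) unfolding AB excess_def case_prod_conv below[OF no0(1)] below[OF no0(2)] by simp
  then have len1: "length ?R1 = t + length ?L1" by linarith
  have "length ?R1 + length ?R2 = p" "Suc (length ?L1 + length ?L2) = q"
    using arg_cong[OF R, of length] arg_cong[OF L, of length] card by simp_all
  then have len2: "length ?R2 \<le> length ?L2" using len1 pq by linarith
  have "semistandard (stage_filling t z)"
    by (rule semistandard_stage_filling[OF z])
  moreover have "step z \<in> level r (Suc p) (q - 1) (- int (Suc t))"
    using step_level[OF z m] by (simp only: of_nat_Suc minus_add_distrib diff_conv_add_uminus add.commute)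
  then have "semistandard (stage_filling (Suc t) (step z))"
    by (rule semistandard_stage_filling)
  ultimately show "jdt_slide (stage_filling t z) (stage_filling (Suc t) (step z))"
    and "jdt_slide (stage_filling (Suc t) (step z)) (stage_filling t z)"
    unfolding T T' using jdt_slides_skew_filling[OF len1 len2] by blast+
qed

lemma steps_are_jdt_slides:
  assumes z: "z \<in> level r p q 0" and "n \<le> q - p"
  shows "jdt_slide\<^sup>*\<^sup>* (stage_filling 0 z) (stage_filling n ((step ^^ n) z)) \<and>
    jdt_slide\<^sup>*\<^sup>* (stage_filling n ((step ^^ n) z)) (stage_filling 0 z)"
  using assms(2)
proof (induction n)
  case (Suc n)
  have "(step ^^ n) z \<in> level r (p + n) (q - n) (- int n)"
    using strict_bij_image[OF steps_strict_bij[of n q p r]] z Suc.prems by simp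
  moreover have "p + n < q - n + n" using Suc.prems by simp
  ultimately have
    "jdt_slide (stage_filling n ((step ^^ n) z)) (stage_filling (Suc n) ((step ^^ Suc n) z))"
    "jdt_slide (stage_filling (Suc n) ((step ^^ Suc n) z)) (stage_filling n ((step ^^ n) z))"
    using step_is_jdt_slide[of "(step ^^ n) z" r "p + n" "q - n" n] by simp_all
  then show ?case
    using Suc by (meson Suc_leD converse_rtranclp_into_rtranclp rtranclp.rtrancl_into_rtrancl)
qed simp

lemma cartan_map_is_jdt:
  assumes z: "z \<in> cartan_pairs r p q"
  shows "jdt_slide\<^sup>*\<^sup>* (stage_filling (p - q) z) (stage_filling (q - p) (cartan_map r p q z))"
proof (cases "p \<le> q")
  case True
  then show ?thesis
    using steps_are_jdt_slides[of z r p q "q - p"] z by (simp add: cartan_pairs_def cartan_map_def)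
next
  case False
  then have map: "cartan_map r p q = inv_into (cartan_pairs r q p) (step ^^ (p - q))"
    by (simp add: cartan_map_def)
  have "z \<in> (step ^^ (p - q)) ` cartan_pairs r q p"
    using strict_bij_surj[OF steps_cartan_strict_bij[of q p r]] z False by simp
  then have "cartan_map r p q z \<in> cartan_pairs r q p" "(step ^^ (p - q)) (cartan_map r p q z) = z"
    unfolding map by (auto intro: inv_into_into f_inv_into_f)
  then show ?thesis
    using steps_are_jdt_slides[of "cartan_map r p q z" r q p "p - q"] False
    by (simp add: cartan_pairs_def)
qed

text \<open>After \<open>j - i\<close> outward slides, respectively \<open>i - j\<close> inward slides, the columns are aligned as
  \<open>two_column\<close> prescribes: the displacement of the left column at the start and at the end is one
  of the truncated differences \<open>i - j\<close> and \<open>j - i\<close>.\<close>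

theorem lemma6p2:
  fixes r i j :: nat and b b' :: "nat list"
  assumes "i \<in> {1..r}" and "j \<in> {1..r}"
    and "([b], [b']) \<in> cartan_component r (fund_wt i) (fund_wt j)"
  shows "\<exists>c c'. cartan_braiding r (fund_wt i) (fund_wt j) ([b], [b']) = Some ([c], [c']) \<and>
                jdt_slide\<^sup>*\<^sup>* (two_column b b') (two_column c c')"
proof -
  have filling: "stage_filling (p - q) (A, B) = two_column (col A) (col B)"
    if "(A, B) \<in> cartan_pairs r p q" for A B p q
    using that cartan_pairs_sub[of r p q]
    by (auto simp: stage_filling_def two_column_eq pairs_def)
  obtain z where z: "z \<in> cartan_pairs r i j" "([b], [b']) = encode z"
    using assms(3) unfolding cartan_component_eq(1)[OF assms(1,2)] by blast
  let ?w = "cartan_map r i j z"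
  have w: "?w \<in> cartan_pairs r j i"
    using strict_bij_image[OF cartan_map_strict_bij] z(1) by simp
  obtain A B where AB: "z = (A, B)" by (metis surj_pair)
  obtain C D where CD: "?w = (C, D)" by (metis surj_pair)
  have "b = col A" "b' = col B" using z(2) by (simp_all add: AB encode_def)
  moreover have "jdt_slide\<^sup>*\<^sup>* (two_column (col A) (col B)) (two_column (col C) (col D))"
    using cartan_map_is_jdt[OF z(1), unfolded CD, unfolded AB]
      filling[OF z(1)[unfolded AB]] filling[OF w[unfolded CD]] by simp
  moreover have "cartan_braiding r (fund_wt i) (fund_wt j) ([b], [b']) = Some ([col C], [col D])"
    using cartan_braiding_eq[OF assms(1,2) z(1)] by (simp add: z(2) CD encode_def)
  ultimately show ?thesis by blast
qed

end
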